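(* Let $\mu$ be a probability measure on $2^{[n]}$. If $\mu$ is strongly Rayleigh, then $\mu$ is CNA+ (strongly conditionally negatively associated).
   Context: Notation: $[n]=\{1,\dots,n\}$; for a probability measure $\mu$ on $2^{[n]}$ (with the full $\sigma$-algebra) the generating polynomial is $g_\mu(z_1,\dots,z_n)=\sum_{S\subseteq[n]}\mu(S)z^S$, where $z^S=\prod_{i\in S}z_i$. Stability: a polynomial $f\in\mathbb{C}[z_1,\dots,z_n]$ is stable if $f(z_1,\dots,z_n)\neq 0$ whenever $\mathrm{Im}(z_j)>0$ for all $1\le j\le n$. The measure $\mu$ is strongly Rayleigh if $g_\mu$ is stable. Operations on measures. Let $X_i(S)=1$ if $i\in S$ and $X_i(S)=0$ otherwise ($i\in[n]$). Projection of $\mu$ onto $2^{S}$ ($S\subseteq[n]$): the measure with generating polynomial obtained from $g_\mu$ by setting $z_i=1$ for $i\in[n]\setminus S$. Conditioning: the conditional measure of $\mu$ given the values (0 or 1) of some of the $X_i$ (viewed as a measure on the power set of the remaining indices), provided the conditioning event has positive probability. External field $(a_1,\dots,a_n)$ with $a_i\ge 0$: the measure with generating polynomial $g_\mu(a_1z_1,\dots,a_nz_n)/g_\mu(a_1,\dots,a_n)$, provided $g_\mu(a_1,\dots,a_n)\ne0$. Negative association: $\mu$ is NA if $\int F\,d\mu\int G\,d\mu\ge\int FG\,d\mu$ for all increasing functions $F,G:2^{[n]}\to\mathbb{R}$ (increasing with respect to inclusion) that depend on disjoint sets of coordinates. $\mu$ is CNA if each measure obtained from $\mu$ by conditioning on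 some (or none) of the values of the variables is NA. $\mu$ is CNA+ if each measure obtained from $\mu$ by imposing external fields and projections is CNA. *)

theory Defs
  imports "HOL-Probability.Probability"
begin

text \<open>
  A probability measure on \<open>2\<^sup>J\<close>, for a finite index set \<open>J\<close>, is a \<^typ>\<open>'a set pmf\<close> whose
  support lies in \<^term>\<open>Pow J\<close>. The index set is carried along explicitly, since projection
  and conditioning change it. A polynomial in the variables indexed by \<open>J\<close> is represented by
  its polynomial function.
\<close>

definition measure_on :: "'a set \<Rightarrow> 'a set pmf \<Rightarrow> bool" where
  "measure_on J \<mu> \<longleftrightarrow> set_pmf \<mu> \<subseteq> Pow J"

definition gen_poly :: "'a set \<Rightarrow> 'a set pmf \<Rightarrow> ('a \<Rightarrow> complex) \<Rightarrow> complex" where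
  "gen_poly J \<mu> z = (\<Sum>S\<in>Pow J. of_real (pmf \<mu> S) * (\<Prod>i\<in>S. z i))"

definition stable :: "'a set \<Rightarrow> (('a \<Rightarrow> complex) \<Rightarrow> complex) \<Rightarrow> bool" where
  "stable J f \<longleftrightarrow> (\<forall>z. (\<forall>j\<in>J. Im (z j) > 0) \<longrightarrow> f z \<noteq> 0)"

definition strongly_Rayleigh :: "'a set \<Rightarrow> 'a set pmf \<Rightarrow> bool" where
  "strongly_Rayleigh J \<mu> \<longleftrightarrow> stable J (gen_poly J \<mu>)"


definition coord :: "'a \<Rightarrow> 'a set \<Rightarrow> nat" where
  "coord i S = (if i \<in> S then 1 else 0)"

text \<open>
  Projection and external field are given by their generating polynomials, as relations
  between the old and the new measure; the lemmas at the end of this theory show that the new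
  measure exists and is unique.
\<close>

definition is_projection :: "'a set \<Rightarrow> 'a set pmf \<Rightarrow> 'a set \<Rightarrow> 'a set pmf \<Rightarrow> bool" where
  "is_projection J \<mu> S \<nu> \<longleftrightarrow> S \<subseteq> J \<and> measure_on S \<nu> \<and>
     (\<forall>z. gen_poly S \<nu> z = gen_poly J \<mu> (\<lambda>i. if i \<in> S then z i else 1))"

definition is_external_field :: "'a set \<Rightarrow> 'a set pmf \<Rightarrow> ('a \<Rightarrow> real) \<Rightarrow> 'a set pmf \<Rightarrow> bool" where
  "is_external_field J \<mu> a \<nu> \<longleftrightarrow>
     (\<forall>i\<in>J. a i \<ge> 0) \<and> gen_poly J \<mu> (\<lambda>i. of_real (a i)) \<noteq> 0 \<and> measure_on J \<nu> \<and>
     (\<forall>z. gen_poly J \<nu> z =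
        gen_poly J \<mu> (\<lambda>i. of_real (a i) * z i) / gen_poly J \<mu> (\<lambda>i. of_real (a i)))"

definition cond_event :: "'a set \<Rightarrow> ('a \<Rightarrow> nat) \<Rightarrow> 'a set set" where
  "cond_event K x = {S. \<forall>i\<in>K. coord i S = x i}"

text \<open>
  The values \<open>x i\<close> of the coordinates in \<open>K\<close> are prescribed; afterwards these coordinates are
  dropped, so that the result is a measure on the subsets of the remaining indices. Meaningful
  only if \<^term>\<open>cond_event K x\<close> has positive probability.
\<close>

definition conditioned :: "'a set pmf \<Rightarrow> 'a set \<Rightarrow> ('a \<Rightarrow> nat) \<Rightarrow> 'a set pmf" where
  "conditioned \<mu> K x = map_pmf (\<lambda>S. S - K) (cond_pmf \<mu> (cond_event K x))"


definition depends_only_on :: "'a set \<Rightarrow> 'a set \<Rightarrow> ('a set \<Rightarrow> real) \<Rightarrow> bool" where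
  "depends_only_on J A F \<longleftrightarrow> (\<forall>S\<in>Pow J. \<forall>T\<in>Pow J. S \<inter> A = T \<inter> A \<longrightarrow> F S = F T)"

definition NA :: "'a set \<Rightarrow> 'a set pmf \<Rightarrow> bool" where
  "NA J \<mu> \<longleftrightarrow> (\<forall>F G :: 'a set \<Rightarrow> real.
     mono_on (Pow J) F \<longrightarrow> mono_on (Pow J) G \<longrightarrow>
     (\<exists>A B. A \<subseteq> J \<and> B \<subseteq> J \<and> A \<inter> B = {} \<and> depends_only_on J A F \<and> depends_only_on J B G) \<longrightarrow>
     measure_pmf.expectation \<mu> F * measure_pmf.expectation \<mu> G
       \<ge> measure_pmf.expectation \<mu> (\<lambda>S. F S * G S))"

definition CNA :: "'a set \<Rightarrow> 'a set pmf \<Rightarrow> bool" where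
  "CNA J \<mu> \<longleftrightarrow> (\<forall>(K :: 'a set) (x :: 'a \<Rightarrow> nat). K \<subseteq> J \<longrightarrow> (\<forall>i\<in>K. x i \<in> {0, 1}) \<longrightarrow>
     measure_pmf.prob \<mu> (cond_event K x) > 0 \<longrightarrow> NA (J - K) (conditioned \<mu> K x))"

text \<open>Any number of external fields and projections, in any order.\<close>

inductive obtained_from :: "'a set \<Rightarrow> 'a set pmf \<Rightarrow> 'a set \<Rightarrow> 'a set pmf \<Rightarrow> bool"
  for I :: "'a set" and \<mu> :: "'a set pmf" where
  start: "obtained_from I \<mu> I \<mu>"
| projection: "obtained_from I \<mu> J \<nu> \<Longrightarrow> is_projection J \<nu> S \<nu>' \<Longrightarrow> obtained_from I \<mu> S \<nu>'"
| external_field: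
    "obtained_from I \<mu> J \<nu> \<Longrightarrow> is_external_field J \<nu> a \<nu>' \<Longrightarrow> obtained_from I \<mu> J \<nu>'"

definition CNA_plus :: "'a set \<Rightarrow> 'a set pmf \<Rightarrow> bool" where
  "CNA_plus I \<mu> \<longleftrightarrow> (\<forall>J \<nu>. obtained_from I \<mu> J \<nu> \<longrightarrow> CNA J \<nu>)"


lemma gen_poly_eq_expectation:
  assumes "finite J" "measure_on J \<mu>"
  shows "gen_poly J \<mu> z = measure_pmf.expectation \<mu> (\<lambda>S. \<Prod>i\<in>S. z i)"
  unfolding gen_poly_def
  by (subst integral_measure_pmf[of "Pow J"])
     (use assms in \<open>auto simp: measure_on_def scaleR_conv_of_real\<close>)

lemma gen_poly_inject:
  assumes J: "finite J" and mu: "measure_on J \<mu>" and nu: "measure_on J \<nu>"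
    and eq: "\<And>z. gen_poly J \<mu> z = gen_poly J \<nu> z"
  shows "\<mu> = \<nu>"
proof -
  have ev: "gen_poly J \<rho> (\<lambda>i. if i \<in> T then 1 else 0) = of_real (\<Sum>S\<in>Pow T. pmf \<rho> S)"
    if T: "T \<subseteq> J" for T and \<rho> :: "'a set pmf"
  proof -
    have "(\<Prod>i\<in>S. if i \<in> T then 1 else 0 :: complex) = (if S \<subseteq> T then 1 else 0)"
      if "S \<in> Pow J" for S
      using finite_subset[OF _ J, of S] that by (auto intro!: prod.neutral)
    hence "gen_poly J \<rho> (\<lambda>i. if i \<in> T then 1 else 0) =
        (\<Sum>S\<in>Pow J. if S \<subseteq> T then of_real (pmf \<rho> S) else 0)"
      unfolding gen_poly_def by (intro sum.cong) auto
    also have "\<dots> = (\<Sum>S\<in>Pow T. of_real (pmf \<rho> S))"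
      using J T by (intro sum.mono_neutral_cong_right) auto
    finally show ?thesis by simp
  qed
  have "pmf \<mu> T = pmf \<nu> T" if "T \<subseteq> J" for T
    using finite_subset[OF that J] that
  proof (induction T rule: finite_psubset_induct)
    case (psubset T)
    have "(\<Sum>S\<in>Pow T. pmf \<mu> S) = (\<Sum>S\<in>Pow T. pmf \<nu> S)"
      using ev[OF psubset.prems, of \<mu>] ev[OF psubset.prems, of \<nu>] eq
      by (metis of_real_eq_iff)
    moreover have "(\<Sum>S\<in>Pow T - {T}. pmf \<mu> S) = (\<Sum>S\<in>Pow T - {T}. pmf \<nu> S)"
      using psubset by (intro sum.cong) auto
    moreover have "(\<Sum>S\<in>Pow T. pmf \<rho> S) = pmf \<rho> T + (\<Sum>S\<in>Pow T - {T}. pmf \<rho> S)"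
      for \<rho> :: "'a set pmf"
      using psubset.hyps by (intro sum.remove) auto
    ultimately show ?case by simp
  qed
  moreover have "pmf \<mu> T = 0" "pmf \<nu> T = 0" if "\<not> T \<subseteq> J" for T
    using that mu nu by (auto simp: measure_on_def set_pmf_iff)
  ultimately show ?thesis by (metis pmf_eqI)
qed

lemma is_projection_unique:
  "finite J \<Longrightarrow> is_projection J \<mu> S \<nu> \<Longrightarrow> is_projection J \<mu> S \<nu>' \<Longrightarrow> \<nu> = \<nu>'"
  by (rule gen_poly_inject[of S]) (auto simp: is_projection_def finite_subset)

lemma is_external_field_unique:
  "finite J \<Longrightarrow> is_external_field J \<mu> a \<nu> \<Longrightarrow> is_external_field J \<mu> a \<nu>' \<Longrightarrow> \<nu> = \<nu>'"
  by (rule gen_poly_inject[of J]) (auto simp: is_external_field_def)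

lemma is_projection_map_pmf:
  assumes J: "finite J" and mu: "measure_on J \<mu>" and S: "S \<subseteq> J"
  shows "is_projection J \<mu> S (map_pmf (\<lambda>T. T \<inter> S) \<mu>)"
proof -
  have m: "measure_on S (map_pmf (\<lambda>T. T \<inter> S) \<mu>)"
    by (auto simp: measure_on_def)
  have "gen_poly S (map_pmf (\<lambda>T. T \<inter> S) \<mu>) z = gen_poly J \<mu> (\<lambda>i. if i \<in> S then z i else 1)"
    for z
  proof -
    have "(\<Prod>i\<in>T \<inter> S. z i) = (\<Prod>i\<in>T. if i \<in> S then z i else 1)" if "T \<in> set_pmf \<mu>" for T
    proof -
      have "finite T" using that mu J by (auto simp: measure_on_def intro: finite_subset)
      thus ?thesis by (simp add: prod.inter_restrict)
    qed
    thus ?thesis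
      by (simp add: gen_poly_eq_expectation[OF finite_subset[OF S J] m]
          gen_poly_eq_expectation[OF J mu] AE_measure_pmf_iff cong: integral_cong_AE)
         (intro integral_cong_AE, auto simp: AE_measure_pmf_iff)
  qed
  thus ?thesis using m S by (auto simp: is_projection_def)
qed

lemma is_external_field_exists:
  assumes J: "finite J" and a: "\<forall>i\<in>J. a i \<ge> 0"
    and nz: "gen_poly J \<mu> (\<lambda>i. of_real (a i)) \<noteq> 0"
  shows "\<exists>\<nu>. is_external_field J \<mu> a \<nu>"
proof -
  define w where "w = (\<lambda>S. if S \<subseteq> J then pmf \<mu> S * (\<Prod>i\<in>S. a i) else 0)"
  define Z where "Z = (\<Sum>S\<in>Pow J. w S)"
  have Z: "gen_poly J \<mu> (\<lambda>i. of_real (a i)) = of_real Z"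
    by (simp add: gen_poly_def Z_def w_def)
  have w: "w S \<ge> 0" for S
    using a by (auto simp: w_def intro!: mult_nonneg_nonneg prod_nonneg)
  have Zpos: "Z > 0"
  proof -
    have "Z \<noteq> 0" using nz Z by auto
    moreover have "Z \<ge> 0" unfolding Z_def using w by (intro sum_nonneg)
    ultimately show ?thesis by linarith
  qed
  define f where "f = (\<lambda>S. w S / Z)"
  have f: "f S \<ge> 0" for S using w Zpos by (simp add: f_def)
  have sub: "(\<lambda>S. ennreal (f S)) = (\<lambda>S. ennreal (f S) * indicator (Pow J) S)"
    by (auto simp: f_def w_def indicator_def)
  have "(\<integral>\<^sup>+ S. ennreal (f S) \<partial>count_space UNIV) = (\<Sum>S\<in>Pow J. ennreal (f S))"
    using J by (subst sub, subst nn_integral_count_space_indicator[symmetric])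
      (auto simp: nn_integral_count_space_finite)
  also have "\<dots> = ennreal (\<Sum>S\<in>Pow J. f S)" using f by simp
  also have "(\<Sum>S\<in>Pow J. f S) = 1"
    using Zpos by (simp add: f_def flip: sum_divide_distrib Z_def)
  finally have pm: "pmf (embed_pmf f) S = f S" for S
    using f by (intro pmf_embed_pmf) auto
  have "f S = 0" if "\<not> S \<subseteq> J" for S
    using that by (simp add: f_def w_def)
  hence "measure_on J (embed_pmf f)"
    unfolding measure_on_def by (metis PowI pm set_pmf_iff subsetI)
  moreover have "gen_poly J (embed_pmf f) z =
      gen_poly J \<mu> (\<lambda>i. of_real (a i) * z i) / gen_poly J \<mu> (\<lambda>i. of_real (a i))" for z
    unfolding Z unfolding gen_poly_def pm sum_divide_distrib
    by (intro sum.cong) (auto simp: f_def w_def prod.distrib)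
  ultimately show ?thesis using a nz by (auto simp: is_external_field_def)
qed

end

theory Submission
  imports Defs "HOL-Complex_Analysis.Complex_Analysis"
begin

text \<open>
  Stability is preserved by external fields, projections and conditioning, so it suffices to prove
  negative association, which follows the induction of Feder and Mihail: choose a coordinate that
  is nonnegatively correlated with \<open>F\<close>, condition on it, and compare the two parts. For
  homogeneous measures such a coordinate exists because the coordinates have a constant sum. No
  homogenization is used here. Instead, under the external field \<open>s\<close> on all coordinates the
  expectation of an increasing function grows with \<open>s\<close>, which is proved in the same induction and
  yields the coordinate. The analytic input, besides Hurwitz's theorem and the Rayleigh inequality,
  is that the odds of a single coordinate grow with \<open>s\<close>: by stability a quotient of diagonal
  polynomials maps the slit plane to itself, and the Schwarz lemma applies.
\<close>

section \<open>Limits of stable polynomials\<close>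

definition wpoly :: "'a set \<Rightarrow> ('a set \<Rightarrow> complex) \<Rightarrow> ('a \<Rightarrow> complex) \<Rightarrow> complex" where
  "wpoly J c z = (\<Sum>S\<in>Pow J. c S * (\<Prod>i\<in>S. z i))"

lemma gen_poly_wpoly: "gen_poly J \<mu> = wpoly J (\<lambda>S. of_real (pmf \<mu> S))"
  by (simp add: gen_poly_def wpoly_def fun_eq_iff)

text \<open>A nonzero limit is nonzero on the connected set \<open>U\<close> by Hurwitz's theorem, applied to
  functions of one complex variable; the boundary point \<open>1\<close> excludes the zero function.\<close>

lemma Hurwitz_combination:
  fixes c :: "nat \<Rightarrow> 's \<Rightarrow> complex" and Q :: "'s \<Rightarrow> complex \<Rightarrow> complex"
  assumes "finite A"
    and Q: "\<And>s. s \<in> A \<Longrightarrow> Q s holomorphic_on UNIV"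
    and lim: "\<And>s. s \<in> A \<Longrightarrow> (\<lambda>n. c n s) \<longlonglongrightarrow> d s"
    and U: "open U" "connected U" "0 \<in> U" "1 \<in> closure U"
    and nz: "\<And>n u. u \<in> U \<Longrightarrow> (\<Sum>s\<in>A. c n s * Q s u) \<noteq> 0"
    and one: "(\<Sum>s\<in>A. d s * Q s 1) \<noteq> 0"
  shows "(\<Sum>s\<in>A. d s * Q s 0) \<noteq> 0"
proof -
  define g where "g u = (\<Sum>s\<in>A. d s * Q s u)" for u
  have holQ: "Q s holomorphic_on X" if "s \<in> A" for s X
    using Q[OF that] holomorphic_on_subset by blast
  have holg: "g holomorphic_on X" for X
    unfolding g_def by (intro holomorphic_intros holQ)
  show ?thesis
  proof (cases "g constant_on U")
    case True
    then obtain k where k: "\<And>u. u \<in> U \<Longrightarrow> g u = k"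
      unfolding constant_on_def by blast
    have "continuous_on (closure U) g"
      using holg holomorphic_on_imp_continuous_on by blast
    then have "g 1 = k"
      using continuous_constant_on_closure[of U g k 1] k U by blast
    then show ?thesis
      using k[of 0] U one by (simp add: g_def)
  next
    case False
    have ul: "uniform_limit K (\<lambda>n u. \<Sum>s\<in>A. c n s * Q s u) g sequentially"
      if K: "compact K" "K \<subseteq> U" for K
    proof -
      have one_term: "uniform_limit K (\<lambda>n u. c n s * Q s u) (\<lambda>u. d s * Q s u) sequentially"
        if s: "s \<in> A" for s
      proof (rule uniform_lim_mult)
        show "uniform_limit K (\<lambda>n u. c n s) (\<lambda>u. d s) sequentially"
          using lim[OF s] by (simp add: uniform_limit_iff tendsto_iff)
        show "bounded ((\<lambda>u. d s) ` K)"
          by (rule finite_imp_bounded) (auto intro: finite_subset[of _ "{d s}"])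
        show "bounded (Q s ` K)"
          using K holQ[OF s] holomorphic_on_imp_continuous_on compact_continuous_image
            compact_imp_bounded by blast
      qed (rule uniform_limit_const)
      have "uniform_limit K (\<lambda>n u. \<Sum>s\<in>B. c n s * Q s u) (\<lambda>u. \<Sum>s\<in>B. d s * Q s u) sequentially"
        if "finite B" "B \<subseteq> A" for B
        using that
        by (induction B rule: finite_induct) (simp_all add: uniform_limit_const uniform_limit_add one_term)
      then show ?thesis using \<open>finite A\<close> by (simp add: g_def[abs_def])
    qed
    have "g 0 \<noteq> 0"
      by (rule Hurwitz_no_zeros[OF U(1,2) _ holg ul False nz U(3)])
        (auto intro!: holomorphic_intros holQ)
    then show ?thesis by (simp add: g_def)
  qed
qed

text \<open>Two deformations reduce this to one complex variable. Positive real coordinates are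
  approached from the upper half-plane, and these shifts are absorbed into the coefficients. The
  other coordinates move along complex lines to 1, where all variables are positive and the value is
  a sum of nonnegative terms with a positive one among them. \<open>Hurwitz_combination\<close>
  carries the nonvanishing back to \<open>z\<close>.\<close>

lemma wpoly_limit_nonzero:
  fixes w :: "'a set \<Rightarrow> real"
  assumes J: "finite J"
    and w0: "\<And>S. S \<subseteq> J \<Longrightarrow> 0 \<le> w S" and S0: "S0 \<subseteq> J" "0 < w S0"
    and lim: "\<And>S. S \<subseteq> J \<Longrightarrow> (\<lambda>n. c n S) \<longlonglongrightarrow> of_real (w S)"
    and st: "\<And>n. stable J (wpoly J (c n))"
    and z: "\<And>j. j \<in> J \<Longrightarrow> 0 < Im (z j) \<or> Im (z j) = 0 \<and> 0 < Re (z j)"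
  shows "wpoly J (\<lambda>S. of_real (w S)) z \<noteq> 0"
proof -
  define R where "R = {j \<in> J. Im (z j) = 0}"
  define y where "y n j = z j + \<i> / of_nat (Suc n)" for n j
  define p where "p j u = z j + u * (1 - z j)" for j u
  define Q where "Q S u = (\<Prod>j\<in>S - R. p j u)" for S u
  define C where "C n S = c n S * (\<Prod>j\<in>S \<inter> R. y n j)" for n S
  define d where "d S = of_real (w S) * (\<Prod>j\<in>S \<inter> R. z j)" for S
  \<comment> \<open>These parameters keep every nonreal coordinate in the upper half-plane: an
    intersection of half-planes, hence convex, with 1 in its closure.\<close>
  define U where "U = (\<Inter>j\<in>J - R. {u. 0 < Im (p j u)})"
  have fin: "finite S" if "S \<in> Pow J" for S
    using that J finite_subset by auto
  have Imp: "Im (p j (of_real t)) = (1 - t) * Im (z j)" for j t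
    by (simp add: p_def algebra_simps)
  have "open U"
    unfolding U_def p_def using J
    by (intro open_INT finite_Diff ballI open_Collect_less continuous_intros) auto
  have "convex U"
    unfolding U_def
  proof (intro convex_INT)
    fix j assume "j \<in> J - R"
    have "{u. 0 < Im (p j u)} = {u. inner (cnj (- \<i> * (1 - z j))) u > - Im (z j)}"
      by (auto simp: p_def inner_complex_def algebra_simps)
    then show "convex {u. 0 < Im (p j u)}"
      by (simp add: convex_halfspace_gt)
  qed
  then have "connected U" by (rule convex_connected)
  have zpos: "Im (z j) > 0" if "j \<in> J - R" for j
    using that z[of j] by (auto simp: R_def)
  have seg: "of_real t \<in> U" if "t < 1" for t
    using that zpos unfolding U_def Imp by (auto simp: Imp)
  have "0 \<in> U" using seg[of 0] by simp
  have "(\<lambda>n. complex_of_real (1 - 1 / real (Suc n))) \<longlonglongrightarrow> of_real (1 - 0)"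
    by (intro tendsto_intros LIMSEQ_Suc[OF lim_1_over_n])
  moreover have "complex_of_real (1 - 1 / real (Suc n)) \<in> U" for n
    by (rule seg) simp
  ultimately have "1 \<in> closure U"
    unfolding closure_sequential of_real_1 diff_0_right
    by (intro exI[of _ "\<lambda>n. complex_of_real (1 - 1 / real (Suc n))"]) blast
  have split: "(\<Prod>j\<in>S. if j \<in> R then f j else g j) = (\<Prod>j\<in>S \<inter> R. f j) * (\<Prod>j\<in>S - R. g j)"
    if "S \<in> Pow J" for S and f g :: "'a \<Rightarrow> complex"
    using fin[OF that] by (simp add: prod.If_cases Diff_eq)
  have FC: "(\<Sum>S\<in>Pow J. C n S * Q S u) = wpoly J (c n) (\<lambda>j. if j \<in> R then y n j else p j u)" for n u
    unfolding wpoly_def C_def Q_def by (intro sum.cong refl) (simp add: split mult_ac)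
  have Fd: "(\<Sum>S\<in>Pow J. d S * Q S u) = wpoly J (\<lambda>S. of_real (w S)) (\<lambda>j. if j \<in> R then z j else p j u)" for u
    unfolding wpoly_def d_def Q_def by (intro sum.cong refl) (simp add: split mult_ac)
  have "(\<Sum>S\<in>Pow J. d S * Q S 0) \<noteq> 0"
  proof (rule Hurwitz_combination[where c = C and U = U])
    show "finite (Pow J)" using J by simp
    show "Q S holomorphic_on UNIV" for S
      unfolding Q_def[abs_def] p_def by (intro holomorphic_intros)
    show "(\<lambda>n. C n S) \<longlonglongrightarrow> d S" if "S \<in> Pow J" for S
    proof -
      have "(\<lambda>n. y n j) \<longlonglongrightarrow> z j + 0" for j
        unfolding y_def by (intro tendsto_intros LIMSEQ_Suc[OF lim_const_over_n])
      then show ?thesis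
        unfolding C_def d_def using lim[of S] that by (intro tendsto_intros) auto
    qed
    show "(\<Sum>S\<in>Pow J. C n S * Q S u) \<noteq> 0" if "u \<in> U" for n u
      unfolding FC using st[of n, unfolded stable_def, rule_format] that
      by (auto simp: U_def y_def R_def Im_divide_of_nat)
    have re: "(\<Prod>j\<in>S. if j \<in> R then z j else p j 1) = of_real (\<Prod>j\<in>S. if j \<in> R then Re (z j) else 1)" for S
      unfolding of_real_prod by (intro prod.cong refl) (auto simp: p_def R_def complex_eq_iff)
    have pos: "0 < (\<Prod>j\<in>S. if j \<in> R then Re (z j) else 1)" if "S \<subseteq> J" for S
      using that z by (intro prod_pos) (force simp: R_def)
    have "(\<Sum>S\<in>Pow J. d S * Q S 1) = of_real (\<Sum>S\<in>Pow J. w S * (\<Prod>j\<in>S. if j \<in> R then Re (z j) else 1))"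
      unfolding Fd wpoly_def re by (simp only: of_real_sum of_real_mult)
    moreover have "(\<Sum>S\<in>Pow J. w S * (\<Prod>j\<in>S. if j \<in> R then Re (z j) else 1)) > 0"
      using J S0 w0 pos by (intro sum_pos2[of _ S0]) (auto intro!: mult_nonneg_nonneg less_imp_le[OF pos])
    ultimately show "(\<Sum>S\<in>Pow J. d S * Q S 1) \<noteq> 0"
      by (metis of_real_eq_0_iff less_irrefl)
  qed fact+
  then show ?thesis
    unfolding Fd by (simp add: p_def cong: if_cong)
qed

section \<open>Stable weights\<close>

text \<open>Unnormalized measures on a fixed index set: conditioning merely sets entries to zero,
  which leaves \<open>J\<close> unchanged and calls for no renormalization.\<close>

definition stable_weight :: "'a set \<Rightarrow> ('a set \<Rightarrow> real) \<Rightarrow> bool" where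
  "stable_weight J w \<longleftrightarrow>
     finite J \<and> (\<forall>S\<subseteq>J. 0 \<le> w S) \<and> stable J (wpoly J (\<lambda>S. of_real (w S)))"

lemma stable_weight_nonneg: "stable_weight J w \<Longrightarrow> S \<subseteq> J \<Longrightarrow> 0 \<le> w S"
  and stable_weight_finite: "stable_weight J w \<Longrightarrow> finite J"
  by (auto simp: stable_weight_def)

lemma stable_weight_pos:
  assumes "stable_weight J w"
  obtains S where "S \<subseteq> J" "0 < w S"
proof -
  have "wpoly J (\<lambda>S. of_real (w S)) (\<lambda>_. \<i>) \<noteq> 0"
    using assms by (auto simp: stable_weight_def stable_def)
  then obtain S where "S \<in> Pow J" "w S \<noteq> 0"
    unfolding wpoly_def by (metis (no_types, lifting) mult_zero_left of_real_0 sum.neutral)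
  then show ?thesis
    using that[of S] stable_weight_nonneg[OF assms, of S] by auto
qed

lemma stable_weight_limit:
  assumes "finite J" "\<And>S. S \<subseteq> J \<Longrightarrow> 0 \<le> w S" "S0 \<subseteq> J" "0 < w S0"
    and "\<And>S. S \<subseteq> J \<Longrightarrow> (\<lambda>n. c n S) \<longlonglongrightarrow> complex_of_real (w S)"
    and "\<And>n. stable J (wpoly J (c n))"
  shows "stable_weight J w"
  unfolding stable_weight_def stable_def
  using assms wpoly_limit_nonzero[OF assms] by auto

text \<open>This is \<open>wpoly_limit_nonzero\<close> for a constant sequence. Positive real values
  may stand next to points of the upper half-plane, in particular the value 1 that projection
  substitutes.\<close>

lemma stable_weight_nonzero:
  assumes "stable_weight J w"
    and "\<And>j. j \<in> J \<Longrightarrow> 0 < Im (z j) \<or> Im (z j) = 0 \<and> 0 < Re (z j)"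
  shows "wpoly J (\<lambda>S. of_real (w S)) z \<noteq> 0"
proof -
  obtain S0 where "S0 \<subseteq> J" "0 < w S0" using stable_weight_pos[OF assms(1)] .
  then show ?thesis
    using assms
    by (intro wpoly_limit_nonzero[where c = "\<lambda>_ S. of_real (w S)" and ?S0.0 = S0])
      (auto simp: stable_weight_def)
qed

lemma wpoly_field: "wpoly J (\<lambda>S. c S * (\<Prod>i\<in>S. a i)) z = wpoly J c (\<lambda>i. a i * z i)"
  by (simp add: wpoly_def prod.distrib mult_ac)

lemma stable_field:
  assumes "stable J (wpoly J c)" "\<And>i. i \<in> J \<Longrightarrow> 0 < a i"
  shows "stable J (wpoly J (\<lambda>S. c S * (\<Prod>i\<in>S. of_real (a i))))"
  using assms by (simp add: stable_def wpoly_field)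

text \<open>Positive fields preserve the upper half-plane, and nonnegative ones are limits of the
  positive fields \<open>a i + 1 / real (Suc n)\<close>. The set \<open>S0\<close> guarantees that
  the limit is not the zero polynomial.\<close>

lemma stable_weight_field:
  assumes w: "stable_weight J w" and a: "\<And>i. i \<in> J \<Longrightarrow> 0 \<le> a i"
    and S0: "S0 \<subseteq> J" "w S0 * (\<Prod>i\<in>S0. a i) \<noteq> 0"
  shows "stable_weight J (\<lambda>S. w S * (\<Prod>i\<in>S. a i))"
proof -
  have nn: "0 \<le> w S * (\<Prod>i\<in>S. a i)" if "S \<subseteq> J" for S
    using that a stable_weight_nonneg[OF w that] by (intro mult_nonneg_nonneg prod_nonneg) auto
  show ?thesis
  proof (rule stable_weight_limit)
    show "finite J" using stable_weight_finite[OF w] .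
    show "0 < w S0 * (\<Prod>i\<in>S0. a i)" using S0 nn[of S0] by linarith
    show "stable J (wpoly J (\<lambda>S. of_real (w S) * (\<Prod>i\<in>S. of_real (a i + 1 / real (Suc n)))))" for n
      using w a by (intro stable_field) (auto simp: stable_weight_def add_nonneg_pos)
    have "(\<lambda>n. a i + 1 / real (Suc n)) \<longlonglongrightarrow> a i" for i
      using tendsto_add[OF tendsto_const LIMSEQ_Suc[OF lim_1_over_n], of "a i"] by simp
    then show "(\<lambda>n. of_real (w S) * (\<Prod>i\<in>S. complex_of_real (a i + 1 / real (Suc n))))
       \<longlonglongrightarrow> of_real (w S * (\<Prod>i\<in>S. a i))" for S
      unfolding of_real_mult of_real_prod
      by (intro tendsto_mult tendsto_const tendsto_prod tendsto_of_real)
    show "S0 \<subseteq> J" by fact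
    show "0 \<le> w S * (\<Prod>i\<in>S. a i)" if "S \<subseteq> J" for S using nn[OF that] .
  qed
qed

text \<open>Conditioning is a limit of external fields \<open>n\<close> on \<open>X\<close> and \<open>1/n\<close> on \<open>K - X\<close>.\<close>

lemma stable_weight_restrict:
  assumes w: "stable_weight J w" and K: "K \<subseteq> J" "X \<subseteq> K"
    and S0: "S0 \<subseteq> J" "w S0 \<noteq> 0" "S0 \<inter> K = X"
  shows "stable_weight J (\<lambda>S. if S \<inter> K = X then w S else 0)"
proof (rule stable_weight_limit)
  have J: "finite J" using stable_weight_finite[OF w] .
  then show "finite J" .
  show "0 < (if S0 \<inter> K = X then w S0 else 0)"
    using S0 stable_weight_nonneg[OF w S0(1)] by simp
  \<comment> \<open>\<open>m S\<close> counts the coordinates of \<open>K\<close> at which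
    \<open>S\<close> disagrees with \<open>X\<close>. The fields multiply \<open>w S\<close> by
    (n+1)^(|X| - m S), so after division by the common factor (n+1)^|X| exactly the sets with
    \<open>m S = 0\<close> survive in the limit.\<close>
  define m where "m S = card (X - S) + card (S \<inter> (K - X))" for S
  define b where "b n i = (if i \<in> X then real (Suc n) else if i \<in> K then 1 / real (Suc n) else 1)"
    for n i
  have fin: "finite S" if "S \<subseteq> J" for S using finite_subset[OF that J] .
  have finX: "finite X" using K fin by auto
  have prodb: "(\<Prod>i\<in>S. b n i) = real (Suc n) ^ card X * (1 / real (Suc n)) ^ m S" if "S \<subseteq> J" for n S
  proof -
    have "(\<Prod>i\<in>S. b n i) = real (Suc n) ^ card (S \<inter> X) * (1 / real (Suc n)) ^ card (S \<inter> (K - X))"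
    proof -
      have "S \<inter> - X \<inter> K = S \<inter> (K - X)" by auto
      then show ?thesis
        unfolding b_def using fin[OF that] by (simp add: prod.If_cases Collect_mem_eq)
    qed
    moreover have "card X = card (S \<inter> X) + card (X - S)"
      using finX by (metis Int_commute card_Int_Diff)
    ultimately show ?thesis
      by (simp add: m_def power_add power_one_over)
  qed
  have m0: "m S = 0 \<longleftrightarrow> S \<inter> K = X" if "S \<subseteq> J" for S
    using K finX fin[OF that] by (auto simp: m_def)
  define c where "c n S = complex_of_real (w S * (1 / real (Suc n)) ^ m S)" for n S
  show "(\<lambda>n. c n S) \<longlonglongrightarrow> of_real (if S \<inter> K = X then w S else 0)" if "S \<subseteq> J" for S
  proof -
    have "(\<lambda>n. complex_of_real (w S * (1 / real (Suc n)) ^ m S)) \<longlonglongrightarrow> of_real (w S * 0 ^ m S)"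
      by (intro tendsto_intros LIMSEQ_Suc[OF lim_1_over_n])
    moreover have "complex_of_real (w S * 0 ^ m S) = of_real (if S \<inter> K = X then w S else 0)"
      using m0[OF that] by (simp add: power_0_left)
    ultimately show ?thesis unfolding c_def by simp
  qed
  show "stable J (wpoly J (c n))" for n
  proof -
    have "stable J (wpoly J (\<lambda>S. of_real (w S) * (\<Prod>i\<in>S. of_real (b n i))))"
      using w by (intro stable_field) (auto simp: stable_weight_def b_def)
    moreover have "wpoly J (\<lambda>S. of_real (w S) * (\<Prod>i\<in>S. of_real (b n i))) z
        = of_real (real (Suc n) ^ card X) * wpoly J (c n) z" for z
      unfolding wpoly_def sum_distrib_left c_def
      by (intro sum.cong refl) (simp add: prodb flip: of_real_prod of_nat_Suc)
    ultimately show ?thesis by (auto simp: stable_def)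
  qed
  show "0 \<le> (if S \<inter> K = X then w S else 0)" if "S \<subseteq> J" for S
    using stable_weight_nonneg[OF w that] by simp
qed (use S0 in auto)

section \<open>Conditioning on one coordinate and the Rayleigh inequality\<close>

definition on_coord :: "'a \<Rightarrow> ('a set \<Rightarrow> real) \<Rightarrow> 'a set \<Rightarrow> real" where
  "on_coord i w S = (if i \<in> S then w S else 0)"

definition off_coord :: "'a \<Rightarrow> ('a set \<Rightarrow> real) \<Rightarrow> 'a set \<Rightarrow> real" where
  "off_coord i w S = (if i \<in> S then 0 else w S)"

lemma stable_weight_on_coord:
  assumes "stable_weight J w" "S0 \<subseteq> J" "w S0 \<noteq> 0" "i \<in> S0"
  shows "stable_weight J (on_coord i w)"
proof -
  have "on_coord i w = (\<lambda>S. if S \<inter> {i} = {i} then w S else 0)"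
    by (auto simp: on_coord_def fun_eq_iff)
  then show ?thesis
    using stable_weight_restrict[of J w "{i}" "{i}" S0] assms by auto
qed

lemma stable_weight_off_coord:
  assumes "stable_weight J w" "S0 \<subseteq> J" "w S0 \<noteq> 0" "i \<notin> S0" "i \<in> J"
  shows "stable_weight J (off_coord i w)"
proof -
  have "off_coord i w = (\<lambda>S. if S \<inter> {i} = {} then w S else 0)"
    by (auto simp: off_coord_def fun_eq_iff)
  then show ?thesis
    using stable_weight_restrict[of J w "{i}" "{}" S0] assms by auto
qed

text \<open>The unnormalized expectation. Inequalities between conditional expectations are stated
  below with the masses multiplied out, so parts of mass zero cause no division.\<close>

definition wint :: "'a set \<Rightarrow> ('a set \<Rightarrow> real) \<Rightarrow> ('a set \<Rightarrow> real) \<Rightarrow> real" where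
  "wint J w F = (\<Sum>S\<in>Pow J. w S * F S)"

abbreviation mass :: "'a set \<Rightarrow> ('a set \<Rightarrow> real) \<Rightarrow> real" where
  "mass J w \<equiv> wint J w (\<lambda>_. 1)"

lemma wint_split: "wint J w F = wint J (on_coord i w) F + wint J (off_coord i w) F"
  unfolding wint_def sum.distrib[symmetric]
  by (intro sum.cong) (auto simp: on_coord_def off_coord_def)

text \<open>With the variable of \<open>e\<close> set to \<i>, that of \<open>i\<close> to \<omega>
  and all others to 1, the generating polynomial becomes (d + b \<i>) + (c + a \<i>) \<omega>, in
  the letters of the abbreviations. If a d > b c, its root \<omega> has positive imaginary part,
  contradicting stability.\<close>

lemma pairwise_negative_correlation:
  assumes w: "stable_weight J w" and ij: "i \<in> J" "e \<in> J" "i \<noteq> e"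
  shows "mass J (on_coord i (on_coord e w)) * mass J (off_coord i (off_coord e w))
    \<le> mass J (off_coord i (on_coord e w)) * mass J (on_coord i (off_coord e w))"
    (is "?a * ?d \<le> ?b * ?c")
proof (rule ccontr)
  assume "\<not> ?thesis"
  then have gt: "?b * ?c < ?a * ?d" by simp
  have J: "finite J" using stable_weight_finite[OF w] .
  define z where "z \<omega> j = (if j = e then \<i> else 1) * (if j = i then \<omega> else 1)" for \<omega> :: complex and j
  have "0 \<le> ?b * ?c"
    using stable_weight_nonneg[OF w]
    by (intro mult_nonneg_nonneg) (auto simp: wint_def on_coord_def off_coord_def intro!: sum_nonneg)
  with gt have a0: "?a \<noteq> 0" by auto
  have eval: "wpoly J (\<lambda>S. of_real (w S)) (z \<omega>) = ?d + ?b * \<i> + ?c * \<omega> + ?a * \<i> * \<omega>" for \<omega> :: complex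
  proof -
    have "(\<Prod>j\<in>S. z \<omega> j) = (if e \<in> S then \<i> else 1) * (if i \<in> S then \<omega> else 1)" if "S \<subseteq> J" for S
      using finite_subset[OF that J] by (simp add: z_def prod.distrib prod.delta)
    then show ?thesis
      unfolding wpoly_def wint_def of_real_sum sum_distrib_right sum.distrib[symmetric]
      by (intro sum.cong refl) (auto simp: on_coord_def off_coord_def)
  qed
  define \<omega> where "\<omega> = - (?d + ?b * \<i>) / (?c + ?a * \<i>)"
  have n0: "?c + ?a * \<i> \<noteq> 0" using a0 by (simp add: complex_eq_iff)
  have "0 < Im \<omega>"
  proof -
    have "Im \<omega> = (?a * ?d - ?b * ?c) / (?c\<^sup>2 + ?a\<^sup>2)"
      by (simp add: \<omega>_def Im_divide mult.commute)
    moreover have "0 < ?c\<^sup>2 + ?a\<^sup>2" using a0 by (simp add: sum_power2_gt_zero_iff)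
    ultimately show ?thesis using gt by simp
  qed
  then have "wpoly J (\<lambda>S. of_real (w S)) (z \<omega>) \<noteq> 0"
    using ij by (intro stable_weight_nonzero[OF w]) (auto simp: z_def)
  moreover have "wpoly J (\<lambda>S. of_real (w S)) (z \<omega>) = (?d + ?b * \<i>) + (?c + ?a * \<i>) * \<omega>"
    unfolding eval by (simp only: distrib_right add.assoc)
  moreover have "(?c + ?a * \<i>) * \<omega> = - (?d + ?b * \<i>)"
    by (simp only: \<omega>_def times_divide_eq_right nonzero_mult_div_cancel_left[OF n0])
  ultimately show False
    by (simp only: add.right_inverse)
qed

section \<open>Monotonicity of odds\<close>

text \<open>Conjugation by the square root turns \<open>h\<close> into a self-map of the right half-plane, to which
  the Schwarz lemma applies after a Cayley transform.\<close>

lemma slit_plane_self_map_bound: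
  assumes hol: "h holomorphic_on - \<real>\<^sub>\<le>\<^sub>0"
    and self: "\<And>u. u \<notin> \<real>\<^sub>\<le>\<^sub>0 \<Longrightarrow> h u \<notin> \<real>\<^sub>\<le>\<^sub>0"
    and s: "0 < s" and a: "h 1 = of_real a" and b: "h (of_real s) = of_real b" and s1: "s \<le> 1"
  shows "s * a \<le> b"
proof -
  have sq: "v\<^sup>2 \<notin> \<real>\<^sub>\<le>\<^sub>0" if "0 < Re v" for v :: complex
    using that by (auto simp: complex_nonpos_Reals_iff power2_eq_square mult_le_0_iff)
  have Re_csqrt: "0 < Re (csqrt v)" if "v \<notin> \<real>\<^sub>\<le>\<^sub>0" for v
  proof (rule ccontr)
    assume "\<not> ?thesis"
    then have "Re (csqrt v) = 0" using csqrt_principal[of v] by auto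
    then have "(csqrt v)\<^sup>2 \<in> \<real>\<^sub>\<le>\<^sub>0"
      unfolding complex_nonpos_Reals_iff by (simp add: power2_eq_square)
    then show False using that by simp
  qed
  define C where "C \<xi> = (1 + \<xi>) / (1 - \<xi>)" for \<xi> :: complex
  define k where "k v = csqrt (h (v\<^sup>2))" for v
  define \<kappa> where "\<kappa> = sqrt a"
  \<comment> \<open>\<open>C\<close> is the Cayley transform from the unit disc to the right
    half-plane with \<open>C 0 = 1\<close>. Since \<open>k 1 = \<kappa>\<close>, the map
    \<open>f\<close> is a self-map of the disc that fixes 0.\<close>
  define f where "f \<xi> = (k (C \<xi>) - \<kappa>) / (k (C \<xi>) + \<kappa>)" for \<xi>
  have pos: "0 < a" "0 < b"
    using self[of 1] self[of "of_real s"] a b s by (auto simp: complex_nonpos_Reals_iff)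
  have \<kappa>: "0 < \<kappa>" using pos by (simp add: \<kappa>_def)
  have ReC: "0 < Re (C \<xi>)" if "norm \<xi> < 1" for \<xi>
  proof -
    have "1 - \<xi> \<noteq> 0" using that by auto
    then have "0 < (1 - Re \<xi>)\<^sup>2 + (Im \<xi>)\<^sup>2"
      by (simp add: complex_eq_iff sum_power2_gt_zero_iff)
    moreover have "(norm \<xi>)\<^sup>2 < 1" using that by (simp add: power_less_one_iff)
    then have "(Re \<xi>)\<^sup>2 + (Im \<xi>)\<^sup>2 < 1" by (simp add: cmod_power2)
    then have "0 < (1 + Re \<xi>) * (1 - Re \<xi>) - Im \<xi> * Im \<xi>"
      by (simp add: power2_eq_square algebra_simps)
    ultimately show ?thesis by (simp add: C_def Re_divide)
  qed
  have Rek: "0 < Re (k v)" if "0 < Re v" for v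
    unfolding k_def by (intro Re_csqrt self sq that)
  have Rekk: "0 < Re (k (C \<xi>))" if "norm \<xi> < 1" for \<xi>
    using Rek ReC that by auto
  have nz: "k (C \<xi>) + \<kappa> \<noteq> 0" if "norm \<xi> < 1" for \<xi>
    using Rekk[OF that] \<kappa> by (auto simp: complex_eq_iff)
  have "C holomorphic_on ball 0 1"
    unfolding C_def by (intro holomorphic_intros) auto
  then have "(\<lambda>\<xi>. h ((C \<xi>)\<^sup>2)) holomorphic_on ball 0 1"
    using sq ReC
    by (intro holomorphic_on_compose_gen[OF _ hol, unfolded o_def] holomorphic_intros) auto
  then have "f holomorphic_on ball 0 1"
    unfolding f_def k_def using nz
    by (intro holomorphic_intros) (auto simp: k_def intro!: self sq ReC)
  moreover have "f 0 = 0"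
    using a pos by (simp add: f_def k_def C_def \<kappa>_def)
  moreover have "norm (f \<xi>) < 1" if "norm \<xi> < 1" for \<xi>
  proof -
    have "(norm (k (C \<xi>) - \<kappa>))\<^sup>2 < (norm (k (C \<xi>) + \<kappa>))\<^sup>2"
      using Rekk[OF that] \<kappa> unfolding cmod_power2
      by (simp add: power2_eq_square algebra_simps)
    then have "norm (k (C \<xi>) - \<kappa>) < norm (k (C \<xi>) + \<kappa>)"
      by (rule power_less_imp_less_base) simp
    then show ?thesis
      using nz[OF that] by (simp add: f_def norm_divide divide_less_eq)
  qed
  moreover define r where "r = sqrt s"
  moreover have r: "0 < r" "r \<le> 1" using s s1 by (auto simp: r_def)
  \<comment> \<open>\<open>x\<close> is the point of the disc with \<open>C x = r\<close>; there
    \<open>k\<close> takes the square root of \<open>h s\<close>.\<close>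
  moreover define x where "x = (r - 1) / (r + 1)"
  moreover have x: "\<bar>x\<bar> = (1 - r) / (1 + r)"
    using r by (simp add: x_def abs_divide)
  moreover have "\<bar>x\<bar> < 1" using r by (simp add: x)
  ultimately have le: "norm (f (of_real x)) \<le> \<bar>x\<bar>"
    using Schwarz_Lemma(1)[of f "of_real x"] by (metis norm_of_real)
  have "C (of_real x) = of_real r"
  proof -
    have "(1 + x) / (1 - x) = r" using r by (simp add: x_def field_simps)
    then show ?thesis unfolding C_def by (metis of_real_1 of_real_add of_real_diff of_real_divide)
  qed
  then have kx: "k (C (of_real x)) = of_real (sqrt b)"
    using pos s by (simp add: k_def r_def b flip: of_real_power)
  have "f (of_real x) = of_real ((sqrt b - \<kappa>) / (sqrt b + \<kappa>))"
    by (simp add: f_def kx)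
  then have "\<bar>(sqrt b - \<kappa>) / (sqrt b + \<kappa>)\<bar> \<le> (1 - r) / (1 + r)"
    using le x by (metis norm_of_real)
  \<comment> \<open>Clearing denominators turns this side of the Schwarz bound into
    \<open>r * \<kappa> \<le> sqrt b\<close>, whose square is the claim.\<close>
  then have "(\<kappa> - sqrt b) / (sqrt b + \<kappa>) \<le> (1 - r) / (1 + r)"
    unfolding abs_le_iff minus_divide_left by simp
  moreover have "0 < sqrt b + \<kappa>" using pos \<kappa> by (simp add: add_pos_pos)
  ultimately have "(\<kappa> - sqrt b) * (1 + r) \<le> (1 - r) * (sqrt b + \<kappa>)"
    using r by (simp add: divide_simps mult.commute)
  then have "r * \<kappa> \<le> sqrt b" by (simp add: algebra_simps)
  then have "sqrt (s * a) \<le> sqrt b" by (simp add: r_def \<kappa>_def real_sqrt_mult)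
  then show ?thesis by simp
qed

text \<open>For \<open>u\<close> on or above the real axis \<open>stable_weight_nonzero\<close>
  applies directly. A \<open>u\<close> below the axis is conjugated: the coefficients are real, so
  the value is conjugated as well.\<close>

lemma slit_plane_nonzero:
  assumes w: "stable_weight J w" and u: "u \<notin> \<real>\<^sub>\<le>\<^sub>0"
    and z: "\<And>j. j \<in> J \<Longrightarrow> z j = u \<or> Im (z j) = 0 \<and> 0 < Re (z j)"
  shows "wpoly J (\<lambda>S. of_real (w S)) z \<noteq> 0"
proof (cases "0 \<le> Im u")
  case True
  then have "0 < Im u \<or> Im u = 0 \<and> 0 < Re u"
    using u by (auto simp: complex_nonpos_Reals_iff)
  then show ?thesis using z by (intro stable_weight_nonzero[OF w]) metis
next
  case False
  have "wpoly J (\<lambda>S. of_real (w S)) (\<lambda>j. cnj (z j)) \<noteq> 0"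
  proof (rule stable_weight_nonzero[OF w])
    fix j assume "j \<in> J"
    then show "0 < Im (cnj (z j)) \<or> Im (cnj (z j)) = 0 \<and> 0 < Re (cnj (z j))"
      using z[of j] False by auto
  qed
  moreover have "wpoly J (\<lambda>S. of_real (w S)) (\<lambda>j. cnj (z j)) = cnj (wpoly J (\<lambda>S. of_real (w S)) z)"
    by (simp add: wpoly_def)
  ultimately show ?thesis by simp
qed

text \<open>The external field \<open>s\<close> on every coordinate, unnormalized. As a function of
  \<open>s\<close>, its mass is the generating polynomial on the diagonal.\<close>

definition damp :: "real \<Rightarrow> ('a set \<Rightarrow> real) \<Rightarrow> 'a set \<Rightarrow> real" where
  "damp s w S = w S * s ^ card S"

lemma on_coord_damp: "on_coord i (damp s w) = damp s (on_coord i w)"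
  and off_coord_damp: "off_coord i (damp s w) = damp s (off_coord i w)"
  by (auto simp: on_coord_def off_coord_def damp_def fun_eq_iff)

lemma wint_nonneg:
  assumes "\<And>S. S \<subseteq> J \<Longrightarrow> 0 \<le> w S" "\<And>S. S \<subseteq> J \<Longrightarrow> 0 \<le> F S"
  shows "0 \<le> wint J w F"
  unfolding wint_def using assms by (intro sum_nonneg mult_nonneg_nonneg) auto

lemma mass_pos:
  assumes "finite J" "\<And>S. S \<subseteq> J \<Longrightarrow> 0 \<le> w S" "S0 \<subseteq> J" "w S0 \<noteq> 0"
  shows "0 < mass J w"
  unfolding wint_def using assms
  by (intro sum_pos2[of _ S0]) (auto simp: less_le)

lemma mass_nonzero_witness:
  assumes "mass J w \<noteq> 0"
  obtains S where "S \<subseteq> J" "w S \<noteq> 0"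
proof -
  have "\<not> (\<forall>S\<in>Pow J. w S * 1 = 0)"
    using assms unfolding wint_def by (metis sum.neutral)
  then show ?thesis using that by auto
qed

text \<open>With \<open>p0\<close>, \<open>p1\<close> the diagonal restrictions of the parts without and with \<open>e\<close>,
  the function \<open>u p0(u) / p1(u)\<close> maps the slit plane to itself: a nonpositive value \<open>-c\<close> would be
  a zero of the generating polynomial at \<open>z e = c\<close> and \<open>u\<close> elsewhere.\<close>

lemma odds_mono:
  assumes w: "stable_weight J w" and e: "e \<in> J"
    and m1: "mass J (on_coord e w) \<noteq> 0" and m0: "mass J (off_coord e w) \<noteq> 0"
    and s: "0 < s" "s \<le> 1"
  shows "mass J (damp s (on_coord e w)) * mass J (off_coord e w)
    \<le> mass J (on_coord e w) * mass J (damp s (off_coord e w))"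
proof -
  have J: "finite J" using stable_weight_finite[OF w] .
  have w1: "stable_weight J (on_coord e w)"
  proof -
    obtain S where "S \<subseteq> J" "on_coord e w S \<noteq> 0" using mass_nonzero_witness[OF m1] .
    then show ?thesis using stable_weight_on_coord[OF w, of S e] by (auto simp: on_coord_def split: if_splits)
  qed
  have w0: "stable_weight J (off_coord e w)"
  proof -
    obtain S where "S \<subseteq> J" "off_coord e w S \<noteq> 0" using mass_nonzero_witness[OF m0] .
    then show ?thesis using stable_weight_off_coord[OF w, of S e] e by (auto simp: off_coord_def split: if_splits)
  qed
  define p where "p v u = wpoly J (\<lambda>S. of_real (v S)) (\<lambda>_. u)" for v :: "'a set \<Rightarrow> real" and u
  have p_real: "p v (of_real t) = of_real (mass J (damp t v))" for v t
    by (simp add: p_def wpoly_def wint_def damp_def)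
  have p_hol: "p v holomorphic_on X" for v X
    unfolding p_def wpoly_def by (intro holomorphic_intros)
  have p_nz: "p v u \<noteq> 0" if "stable_weight J v" "u \<notin> \<real>\<^sub>\<le>\<^sub>0" for v u
    unfolding p_def using that by (intro slit_plane_nonzero[OF that]) auto
  \<comment> \<open>\<open>on_coord e w\<close> keeps \<open>e\<close> in its sets, so its diagonal
    polynomial carries an extra factor \<open>u\<close>. Thus \<open>- h u\<close> is the zero of
    the generating polynomial in the variable of \<open>e\<close> when all other variables equal
    \<open>u\<close>.\<close>
  define h where "h u = u * p (off_coord e w) u / p (on_coord e w) u" for u
  have "h holomorphic_on - \<real>\<^sub>\<le>\<^sub>0"
    unfolding h_def using p_nz[OF w1] by (intro holomorphic_intros p_hol) auto
  moreover have "h u \<notin> \<real>\<^sub>\<le>\<^sub>0" if u: "u \<notin> \<real>\<^sub>\<le>\<^sub>0" for u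
  proof
    assume "h u \<in> \<real>\<^sub>\<le>\<^sub>0"
    then obtain c where c: "h u = - of_real c" "0 \<le> c"
      by (metis nonpos_Reals_cases neg_0_le_iff_le of_real_minus minus_minus)
    have u0: "u \<noteq> 0" using u by auto
    have eq: "u * p (off_coord e w) u = - of_real c * p (on_coord e w) u"
      using c(1) p_nz[OF w1 u] by (simp add: h_def divide_eq_eq)
    define z where "z j = (if j = e then of_real c / u else 1) * u" for j
    have "wpoly J (\<lambda>S. of_real (w S)) z = p (off_coord e w) u + of_real c / u * p (on_coord e w) u"
    proof -
      have "(\<Prod>j\<in>S. z j) = (if e \<in> S then of_real c / u else 1) * u ^ card S" if "S \<subseteq> J" for S
        using finite_subset[OF that J] by (simp add: z_def prod.distrib)
      then show ?thesis
        unfolding p_def wpoly_def sum_distrib_left sum.distrib[symmetric]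
        by (intro sum.cong refl) (auto simp: on_coord_def off_coord_def)
    qed
    also have "\<dots> = (u * p (off_coord e w) u + of_real c * p (on_coord e w) u) / u"
      using u0 by (simp add: field_simps)
    also have "\<dots> = 0" unfolding eq by simp
    finally have zero: "wpoly J (\<lambda>S. of_real (w S)) z = 0" .
    show False
    proof (cases "c = 0")
      case True
      then show False using eq u0 p_nz[OF w0 u] by simp
    next
      case False
      moreover have "z j = (if j = e then of_real c else u)" for j
        using u0 by (simp add: z_def)
      ultimately have "wpoly J (\<lambda>S. of_real (w S)) z \<noteq> 0"
        using c by (intro slit_plane_nonzero[OF w u]) auto
      then show False using zero by simp
    qed
  qed
  moreover have h_real: "h (of_real t) = of_real (t * mass J (damp t (off_coord e w)) / mass J (damp t (on_coord e w)))" for t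
    by (simp add: h_def p_real)
  moreover have "h 1 = of_real (mass J (off_coord e w) / mass J (on_coord e w))"
    using h_real[of 1] by (simp add: damp_def[abs_def])
  \<comment> \<open>This is \<open>s * h 1 \<le> h s\<close>. The factor \<open>u\<close> in the
    definition of \<open>h\<close> contributes an \<open>s\<close> on the right that cancels, which
    leaves the comparison of odds.\<close>
  ultimately have le: "s * (mass J (off_coord e w) / mass J (on_coord e w))
      \<le> s * mass J (damp s (off_coord e w)) / mass J (damp s (on_coord e w))"
    using s by (intro slit_plane_self_map_bound[of h]) auto
  have nn: "0 \<le> on_coord e w S" if "S \<subseteq> J" for S using stable_weight_nonneg[OF w1 that] .
  have pos1: "0 < mass J (on_coord e w)"
    using m1 wint_nonneg[of J "on_coord e w" "\<lambda>_. 1"] nn by simp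
  have "p (on_coord e w) (of_real s) \<noteq> 0" using s by (intro p_nz[OF w1]) auto
  then have "mass J (damp s (on_coord e w)) \<noteq> 0" unfolding p_real by auto
  moreover have "0 \<le> mass J (damp s (on_coord e w))"
    using nn s by (intro wint_nonneg) (auto simp: damp_def)
  ultimately have pos2: "0 < mass J (damp s (on_coord e w))" by simp
  have "mass J (off_coord e w) / mass J (on_coord e w)
      \<le> mass J (damp s (off_coord e w)) / mass J (damp s (on_coord e w))"
    using le s by (simp flip: times_divide_eq_right)
  then show ?thesis
    using pos1 pos2 by (simp add: divide_simps mult.commute split: if_splits)
qed

section \<open>Correlation with increasing functions\<close>

lemma wint_single:
  assumes "finite J" "C \<subseteq> J" "\<And>S. S \<subseteq> J \<Longrightarrow> w S \<noteq> 0 \<Longrightarrow> S = C"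
  shows "wint J w F = w C * F C"
proof -
  have "wint J w F = (\<Sum>S\<in>{C}. w S * F S)"
    unfolding wint_def using assms by (intro sum.mono_neutral_right) auto
  then show ?thesis by simp
qed

text \<open>Otherwise every coordinate that is not constant on the support is negatively correlated with
  \<open>F\<close>. By the hypothesis on the conditioned weights this persists under all external fields
  \<open>s \<le> 1\<close>, so the polynomial \<open>D\<close> below decreases strictly on \<open>[0, 1]\<close>. But \<open>D 1 = 0\<close>, and
  \<open>D 0 \<le> 0\<close> since only the least set \<open>C\<close> contributes.\<close>

lemma ex_positively_correlated:
  fixes w F :: "'a set \<Rightarrow> real"
  assumes J: "finite J" and nn: "\<And>S. S \<subseteq> J \<Longrightarrow> 0 \<le> w S" and F: "mono_on (Pow J) F"
    and S12: "S1 \<subseteq> J" "S2 \<subseteq> J" "w S1 \<noteq> 0" "w S2 \<noteq> 0" "S1 \<noteq> S2"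
    and IH: "\<And>i s. i \<in> J \<Longrightarrow> 0 < mass J (on_coord i w) \<Longrightarrow> 0 < mass J (off_coord i w) \<Longrightarrow>
        0 < s \<Longrightarrow> s \<le> 1 \<Longrightarrow>
        wint J (damp s (on_coord i w)) F * mass J (on_coord i w)
        \<le> wint J (on_coord i w) F * mass J (damp s (on_coord i w))"
  obtains i where "i \<in> J" "0 < mass J (on_coord i w)" "0 < mass J (off_coord i w)"
    "wint J (off_coord i w) F * mass J (on_coord i w)
     \<le> wint J (on_coord i w) F * mass J (off_coord i w)"
proof (rule ccontr)
  assume "\<not> thesis"
  with that have neg: "wint J (on_coord i w) F * mass J (off_coord i w)
      < wint J (off_coord i w) F * mass J (on_coord i w)"
    if "i \<in> J" "0 < mass J (on_coord i w)" "0 < mass J (off_coord i w)" for i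
    using that by fastforce
  have fin: "finite S" if "S \<subseteq> J" for S using finite_subset[OF that J] .
  have nn_on: "0 \<le> on_coord i w S" and nn_off: "0 \<le> off_coord i w S" if "S \<subseteq> J" for i S
    using nn[OF that] by (auto simp: on_coord_def off_coord_def)
  \<comment> \<open>The coordinates present in all sets of the support. \<open>C\<close> itself may
    have weight zero, and then \<open>D 0 = 0\<close>.\<close>
  define C where "C = \<Inter>{S. S \<subseteq> J \<and> w S \<noteq> 0}"
  have CS: "C \<subseteq> S" if "S \<subseteq> J" "w S \<noteq> 0" for S using that by (auto simp: C_def)
  have CJ: "C \<subseteq> J" using CS S12 by blast
  define m where "m = wint J w F / mass J w"
  have mw: "0 < mass J w" using S12 J nn by (intro mass_pos[of J w S1])
  \<comment> \<open>Negative correlation relative to the overall mean \<open>m\<close>: conditioning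
    on the presence of \<open>i\<close> pushes the mean of \<open>F\<close> strictly below
    \<open>m\<close>.\<close>
  have below: "wint J (on_coord i w) F < m * mass J (on_coord i w)"
    if i: "i \<in> J" "0 < mass J (on_coord i w)" "0 < mass J (off_coord i w)" for i
  proof -
    have "wint J (on_coord i w) F * mass J w < wint J w F * mass J (on_coord i w)"
      using neg[OF i] unfolding wint_split[of J w _ i] by (simp add: algebra_simps)
    then show ?thesis using mw by (simp add: m_def field_simps)
  qed
  have off_pos: "0 < mass J (off_coord i w)" if "i \<in> J - C" for i
  proof -
    from that obtain S where "S \<subseteq> J" "w S \<noteq> 0" "i \<notin> S" by (auto simp: C_def)
    then show ?thesis
      using J nn_off[of _ i] by (intro mass_pos[of J _ S]) (auto simp: off_coord_def)
  qed
  define g where "g s i = wint J (damp s (on_coord i w)) (\<lambda>S. F S - m)" for s i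
  have g_diff: "g s i = wint J (damp s (on_coord i w)) F - m * mass J (damp s (on_coord i w))" for s i
    by (simp add: g_def wint_def sum_distrib_left algebra_simps sum_subtractf)
  have g_neg: "g s i < 0" if s: "0 < s" "s \<le> 1" and i: "i \<in> J - C" "0 < mass J (on_coord i w)" for s i
  proof -
    have i': "i \<in> J" using i by auto
    obtain S where "S \<subseteq> J" "on_coord i w S \<noteq> 0"
      using mass_nonzero_witness[of J "on_coord i w"] i by auto
    then have ms: "0 < mass J (damp s (on_coord i w))"
      using J s nn_on[of _ i] by (intro mass_pos[of J _ S]) (auto simp: damp_def)
    have "wint J (damp s (on_coord i w)) F * mass J (on_coord i w)
        \<le> wint J (on_coord i w) F * mass J (damp s (on_coord i w))"
      by (rule IH[OF i' i(2) off_pos[OF i(1)] s])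
    also have "\<dots> < (m * mass J (on_coord i w)) * mass J (damp s (on_coord i w))"
      using below[OF i' i(2) off_pos[OF i(1)]] ms by (rule mult_strict_right_mono)
    finally have "wint J (damp s (on_coord i w)) F < m * mass J (damp s (on_coord i w))"
      using i(2) by (simp add: mult.assoc mult.left_commute[of _ "mass J (on_coord i w)"] mult.commute[of _ "mass J (on_coord i w)"])
    then show ?thesis by (simp add: g_diff)
  qed
  have g_nonpos: "g s i \<le> 0" if s: "0 < s" "s \<le> 1" and i: "i \<in> J - C" for s i
  proof (cases "0 < mass J (on_coord i w)")
    case True
    then show ?thesis using g_neg[OF s i] by simp
  next
    case False
    have "on_coord i w S = 0" if "S \<subseteq> J" for S
      using False mass_pos[of J "on_coord i w" S] J nn_on[of _ i] that by blast
    then show ?thesis by (simp add: g_def wint_def damp_def)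
  qed
  obtain i0 where i0: "i0 \<in> J - C" "0 < mass J (on_coord i0 w)"
  proof -
    obtain S where S: "S \<subseteq> J" "w S \<noteq> 0" "S \<noteq> C" using S12 by metis
    then obtain i where "i \<in> S" "i \<notin> C" using CS[OF S(1,2)] by auto
    then show ?thesis
      using S J nn_on[of _ i] by (intro that[of i] mass_pos[of J _ S]) (auto simp: on_coord_def)
  qed
  \<comment> \<open>Up to the factor \<open>s ^ card C\<close>, this is the integral of
    \<open>F - m\<close> under the field \<open>s\<close>. Removing the factor keeps the
    contribution of \<open>C\<close> alive at 0.\<close>
  define D where "D s = (\<Sum>S\<in>Pow J. w S * (F S - m) * s ^ card (S - C))" for s
  define D' where "D' s = (\<Sum>S\<in>Pow J. w S * (F S - m) * (real (card (S - C)) * s ^ (card (S - C) - 1)))" for s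
  have deriv: "(D has_real_derivative D' s) (at s)" for s
    unfolding D_def D'_def by (rule derivative_eq_intros refl | simp add: mult_ac)+
  have D'_neg: "D' s < 0" if s: "0 < s" "s < 1" for s
  proof -
    \<comment> \<open>Differentiation brings down \<open>card (S - C)\<close>, which counts the
      coordinates of \<open>S\<close> outside \<open>C\<close>. Up to a power of \<open>s\<close>
      the derivative is therefore the sum of the \<open>g s i\<close> over these
      coordinates.\<close>
    have "D' s * s ^ Suc (card C) = (\<Sum>S\<in>Pow J. \<Sum>i\<in>J - C. damp s (on_coord i w) S * (F S - m))"
      unfolding D'_def sum_distrib_right
    proof (intro sum.cong refl)
      fix S assume "S \<in> Pow J"
      then have S: "S \<subseteq> J" by simp
      have "(\<Sum>i\<in>J - C. damp s (on_coord i w) S * (F S - m))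
          = (\<Sum>i\<in>J - C. if i \<in> S then w S * s ^ card S * (F S - m) else 0)"
        by (intro sum.cong) (auto simp: damp_def on_coord_def)
      also have "\<dots> = real (card (S - C)) * (w S * s ^ card S * (F S - m))"
      proof -
        have "(J - C) \<inter> S = S - C" using S by auto
        then show ?thesis using J by (simp add: sum.inter_restrict[symmetric])
      qed
      finally have rhs: "(\<Sum>i\<in>J - C. damp s (on_coord i w) S * (F S - m))
          = real (card (S - C)) * (w S * s ^ card S * (F S - m))" .
      show "w S * (F S - m) * (real (card (S - C)) * s ^ (card (S - C) - 1)) * s ^ Suc (card C)
          = (\<Sum>i\<in>J - C. damp s (on_coord i w) S * (F S - m))"
      proof (cases "w S = 0 \<or> card (S - C) = 0")
        case True
        then show ?thesis unfolding rhs by auto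
      next
        case False
        then have "C \<subseteq> S" using CS[OF S] by auto
        then have "card S = card C + card (S - C)"
          using fin[OF S] by (metis card_Diff_subset card_mono finite_subset le_add_diff_inverse)
        then have "card S = (card (S - C) - 1) + Suc (card C)"
          using False by auto
        then have "s ^ card S = s ^ (card (S - C) - 1) * s ^ Suc (card C)"
          by (simp only: power_add)
        then show ?thesis unfolding rhs by simp
      qed
    qed
    also have "\<dots> = (\<Sum>i\<in>J - C. g s i)"
      unfolding g_def wint_def by (rule sum.swap)
    also have "\<dots> < (\<Sum>i\<in>J - C. 0)"
      using J i0 s by (intro sum_strict_mono_ex1) (auto intro!: g_nonpos g_neg bexI[of _ i0])
    finally show ?thesis using s by (simp add: mult_less_0_iff)
  qed
  have "D 1 < D 0"
    using D'_neg by (intro DERIV_neg_imp_decreasing_open[of 0 1 D])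
      (auto intro!: deriv continuous_at_imp_continuous_on DERIV_isCont[OF deriv])
  moreover have "D 1 = 0"
  proof -
    have "D 1 = wint J w F - m * mass J w"
      by (simp add: D_def wint_def sum_distrib_left algebra_simps sum_subtractf)
    then show ?thesis using mw by (simp add: m_def)
  qed
  moreover have "D 0 \<le> 0"
  proof -
    have "D 0 = (\<Sum>S\<in>{C}. w S * (F S - m) * 0 ^ card (S - C))"
      unfolding D_def
    proof (rule sum.mono_neutral_right)
      show "\<forall>S\<in>Pow J - {C}. w S * (F S - m) * 0 ^ card (S - C) = 0"
      proof
        fix S assume "S \<in> Pow J - {C}"
        then have S: "S \<subseteq> J" "S \<noteq> C" by auto
        show "w S * (F S - m) * 0 ^ card (S - C) = 0"
        proof (cases "w S = 0")
          case False
          then have "S - C \<noteq> {}" using CS[OF S(1)] S by auto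
          then have "card (S - C) \<noteq> 0" using fin[OF S(1)] by simp
          then show ?thesis by simp
        qed simp
      qed
    qed (use J CJ in auto)
    then have D0: "D 0 = w C * (F C - m)" by simp
    have "F C * mass J w \<le> wint J w F"
      unfolding wint_def sum_distrib_left
    proof (intro sum_mono)
      fix S assume "S \<in> Pow J"
      then have S: "S \<subseteq> J" by simp
      have "w S * F C \<le> w S * F S"
      proof (cases "w S = 0")
        case False
        then have "F C \<le> F S" using CS[OF S] S CJ by (intro mono_onD[OF F]) auto
        then show ?thesis using nn[OF S] by (rule mult_left_mono)
      qed simp
      then show "F C * (w S * 1) \<le> w S * F S" by (simp add: mult.commute)
    qed
    then have "F C \<le> m" using mw by (simp add: m_def field_simps)
    then show ?thesis using nn[OF CJ] by (simp add: D0 mult_nonneg_nonpos)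
  qed
  ultimately show False by simp
qed

text \<open>Its cardinality is the measure of the inductions below. Conditioning keeps
  \<open>J\<close>, but shrinks the support strictly when both values of the coordinate have
  positive mass.\<close>

definition support :: "'a set \<Rightarrow> ('a set \<Rightarrow> real) \<Rightarrow> 'a set set" where
  "support J w = {S. S \<subseteq> J \<and> w S \<noteq> 0}"

lemma nondegenerate_coord:
  assumes w: "stable_weight J w" and i: "i \<in> J"
    and pos: "0 < mass J (on_coord i w)" "0 < mass J (off_coord i w)"
  shows "stable_weight J (on_coord i w)" "stable_weight J (off_coord i w)"
    "card (support J (on_coord i w)) < card (support J w)"
    "card (support J (off_coord i w)) < card (support J w)"
proof -
  obtain S where S: "S \<subseteq> J" "on_coord i w S \<noteq> 0"
    using mass_nonzero_witness[of J "on_coord i w"] pos by auto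
  obtain T where T: "T \<subseteq> J" "off_coord i w T \<noteq> 0"
    using mass_nonzero_witness[of J "off_coord i w"] pos by auto
  have S': "w S \<noteq> 0" "i \<in> S" and T': "w T \<noteq> 0" "i \<notin> T"
    using S T by (auto simp: on_coord_def off_coord_def split: if_splits)
  show "stable_weight J (on_coord i w)" using stable_weight_on_coord[OF w S(1) S'] .
  show "stable_weight J (off_coord i w)" using stable_weight_off_coord[OF w T(1) T' i] .
  have fin: "finite (support J w)"
    using stable_weight_finite[OF w] by (simp add: support_def)
  have "support J (on_coord i w) \<subset> support J w"
    using T T' by (auto simp: support_def on_coord_def)
  then show "card (support J (on_coord i w)) < card (support J w)"
    by (rule psubset_card_mono[OF fin])
  have "support J (off_coord i w) \<subset> support J w"
    using S S' by (auto simp: support_def off_coord_def)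
  then show "card (support J (off_coord i w)) < card (support J w)"
    by (rule psubset_card_mono[OF fin])
qed

lemma support_single_or_two:
  assumes "stable_weight J w"
  obtains C where "C \<subseteq> J" "\<And>S. S \<subseteq> J \<Longrightarrow> w S \<noteq> 0 \<Longrightarrow> S = C"
  | S1 S2 where "S1 \<subseteq> J" "S2 \<subseteq> J" "w S1 \<noteq> 0" "w S2 \<noteq> 0" "S1 \<noteq> S2"
proof -
  obtain C where "C \<subseteq> J" "0 < w C" using stable_weight_pos[OF assms] .
  then show ?thesis using that by (metis less_irrefl)
qed

text \<open>Read \<open>a\<close>, \<open>b\<close> as the masses of two parts, \<alpha>, \<beta> as
  the integrals over them, and \<open>c\<close>, \<open>d\<close>, \<gamma>, \<delta> as the same
  for a second weight. Passing to the second weight raises both conditional means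
  (\<open>on\<close>, \<open>off\<close>) and shifts mass to the first part (\<open>odds\<close>),
  whose mean is the larger one (\<open>cor\<close>). So the overall mean rises.\<close>

lemma mixture_le:
  fixes a b c d \<alpha> \<beta> \<gamma> \<delta> :: real
  assumes ab: "0 < a" "0 < b" and on: "\<alpha> * c \<le> \<gamma> * a" and off: "\<beta> * d \<le> \<delta> * b"
    and odds: "a * d \<le> b * c" and cor: "\<beta> * a \<le> \<alpha> * b"
  shows "(\<alpha> + \<beta>) * (c + d) \<le> (\<gamma> + \<delta>) * (a + b)"
proof -
  define x y where "x = \<alpha> / a" and "y = \<beta> / b"
  have xy: "\<alpha> = x * a" "\<beta> = y * b" using ab by (simp_all add: x_def y_def)
  have "x * c \<le> \<gamma>" "y * d \<le> \<delta>"
    using on off ab by (simp_all add: xy mult.assoc mult.left_commute[of _ a] mult.left_commute[of _ b]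
        mult.commute[of _ a] mult.commute[of _ b])
  then have "(x * c + y * d) * (a + b) \<le> (\<gamma> + \<delta>) * (a + b)"
    using ab by (intro mult_right_mono) auto
  moreover have "y \<le> x"
    using cor ab by (simp add: x_def y_def divide_simps mult.commute)
  then have "0 \<le> (x - y) * (b * c - a * d)"
    using odds by (intro mult_nonneg_nonneg) auto
  ultimately show ?thesis by (simp add: xy algebra_simps)
qed

text \<open>Condition on the coordinate from \<open>ex_positively_correlated\<close>, whose
  hypothesis is the induction hypothesis for the conditioned weights. A smaller field lowers both
  conditional means by induction and the odds of that coordinate by \<open>odds_mono\<close>, hence
  the overall mean.\<close>

lemma damp_monotone:
  assumes "stable_weight J w" and F: "mono_on (Pow J) F" and s: "0 < s" "s \<le> 1"
  shows "wint J (damp s w) F * mass J w \<le> wint J w F * mass J (damp s w)"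
  using assms(1) s
proof (induction "card (support J w)" arbitrary: w s rule: less_induct)
  case less
  note w = less.prems(1) and s = less.prems(2,3)
  have J: "finite J" using stable_weight_finite[OF w] .
  show ?case
  proof (rule support_single_or_two[OF w])
    fix C assume C: "C \<subseteq> J" "\<And>S. S \<subseteq> J \<Longrightarrow> w S \<noteq> 0 \<Longrightarrow> S = C"
    have single: "wint J w f = w C * f C" "wint J (damp s w) f = damp s w C * f C" for f
      using wint_single[OF J C(1), of w] wint_single[OF J C(1), of "damp s w"] C(2)
      by (auto simp: damp_def)
    show ?case by (simp add: single)
  next
    fix S1 S2 assume S12: "S1 \<subseteq> J" "S2 \<subseteq> J" "w S1 \<noteq> 0" "w S2 \<noteq> 0" "S1 \<noteq> S2"
    have IH_on: "wint J (damp s (on_coord i w)) F * mass J (on_coord i w)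
        \<le> wint J (on_coord i w) F * mass J (damp s (on_coord i w))"
      and IH_off: "wint J (damp s (off_coord i w)) F * mass J (off_coord i w)
        \<le> wint J (off_coord i w) F * mass J (damp s (off_coord i w))"
      if "i \<in> J" "0 < mass J (on_coord i w)" "0 < mass J (off_coord i w)" "0 < s" "s \<le> 1" for i s
      using nondegenerate_coord[OF w that(1-3)] that(4,5) by (auto intro!: less.hyps)
    obtain i where i: "i \<in> J" "0 < mass J (on_coord i w)" "0 < mass J (off_coord i w)"
      and cor: "wint J (off_coord i w) F * mass J (on_coord i w)
        \<le> wint J (on_coord i w) F * mass J (off_coord i w)"
    proof (rule ex_positively_correlated[OF J _ F S12])
      show "0 \<le> w S" if "S \<subseteq> J" for S using stable_weight_nonneg[OF w that] .
    qed (rule IH_on that; assumption)+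
    have odds: "mass J (damp s (on_coord i w)) * mass J (off_coord i w)
        \<le> mass J (on_coord i w) * mass J (damp s (off_coord i w))"
      using odds_mono[OF w i(1) _ _ s] i by simp
    \<comment> \<open>\<open>mixture_le\<close> is used for \<open>- F\<close> with the part without
      \<open>i\<close> first: passing from \<open>w\<close> to \<open>damp s w\<close> raises the
      means of \<open>- F\<close> and shifts mass to that part.\<close>
    show ?case
      using mixture_le[of "mass J (off_coord i w)" "mass J (on_coord i w)"
          "- wint J (off_coord i w) F" "mass J (damp s (off_coord i w))"
          "- wint J (damp s (off_coord i w)) F" "- wint J (on_coord i w) F"
          "mass J (damp s (on_coord i w))" "- wint J (damp s (on_coord i w)) F"]
        i cor odds IH_on[OF i s] IH_off[OF i s]
      unfolding wint_split[of J w _ i] wint_split[of J "damp s w" _ i] on_coord_damp off_coord_damp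
      by (simp add: algebra_simps)
  qed
qed

text \<open>\<open>damp_monotone\<close> discharges the hypothesis of
  \<open>ex_positively_correlated\<close>. The inductions on the support below branch on this
  dichotomy.\<close>

lemma stable_weight_cases:
  assumes w: "stable_weight J w" and F: "mono_on (Pow J) F"
  obtains C where "C \<subseteq> J" "\<And>S. S \<subseteq> J \<Longrightarrow> w S \<noteq> 0 \<Longrightarrow> S = C"
  | i where "i \<in> J" "0 < mass J (on_coord i w)" "0 < mass J (off_coord i w)"
    "wint J (off_coord i w) F * mass J (on_coord i w)
     \<le> wint J (on_coord i w) F * mass J (off_coord i w)"
proof (rule support_single_or_two[OF w])
  fix S1 S2 assume S12: "S1 \<subseteq> J" "S2 \<subseteq> J" "w S1 \<noteq> 0" "w S2 \<noteq> 0" "S1 \<noteq> S2"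
  show thesis
  proof (rule ex_positively_correlated[OF stable_weight_finite[OF w] _ F S12])
    show "0 \<le> w S" if "S \<subseteq> J" for S using stable_weight_nonneg[OF w that] .
    show "wint J (damp s (on_coord i w)) F * mass J (on_coord i w)
        \<le> wint J (on_coord i w) F * mass J (damp s (on_coord i w))"
      if "i \<in> J" "0 < mass J (on_coord i w)" "0 < mass J (off_coord i w)" "0 < s" "s \<le> 1" for i s
      using damp_monotone[OF nondegenerate_coord(1)[OF w that(1-3)] F that(4,5)] .
  qed (rule that(2))
qed (rule that(1))

section \<open>Negative correlation with a coordinate, and negative association\<close>

lemma on_coord_commute: "on_coord i (on_coord e w) = on_coord e (on_coord i w)"
  "off_coord i (off_coord e w) = off_coord e (off_coord i w)"
  "on_coord i (off_coord e w) = off_coord e (on_coord i w)"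
  by (auto simp: on_coord_def off_coord_def fun_eq_iff)

text \<open>Given the presence of \<open>e\<close>, take a coordinate \<open>i\<close> positively
  correlated with \<open>F\<close>. Passing to the absence of \<open>e\<close> makes
  \<open>i\<close> more likely by the Rayleigh inequality and raises the mean of \<open>F\<close>
  for either value of \<open>i\<close> by induction, so \<open>mixture_le\<close> applies. If
  instead only one set \<open>C\<close> of the support contains \<open>e\<close>, then every other
  set of the support contains \<open>C - {e}\<close>, where \<open>F\<close> has the value
  \<open>F C\<close>.\<close>

lemma coordinate_negatively_correlated:
  assumes "stable_weight J w" and e: "e \<in> J" and F: "mono_on (Pow J) F"
    and dep: "depends_only_on J (J - {e}) F"
  shows "wint J (on_coord e w) F * mass J (off_coord e w)
    \<le> wint J (off_coord e w) F * mass J (on_coord e w)"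
  using assms(1)
proof (induction "card (support J w)" arbitrary: w rule: less_induct)
  case less
  note w = less.prems(1)
  have J: "finite J" using stable_weight_finite[OF w] .
  have nn: "0 \<le> w S" if "S \<subseteq> J" for S using stable_weight_nonneg[OF w that] .
  show ?case
  proof (cases "\<exists>S\<subseteq>J. on_coord e w S \<noteq> 0")
    case False
    then show ?thesis by (simp add: wint_def)
  next
    case True
    then obtain S0 where "S0 \<subseteq> J" "w S0 \<noteq> 0" "e \<in> S0" by (auto simp: on_coord_def split: if_splits)
    then have w1: "stable_weight J (on_coord e w)" by (rule stable_weight_on_coord[OF w])
    show ?thesis
    proof (rule stable_weight_cases[OF w1 F])
      fix C assume C: "C \<subseteq> J" "\<And>S. S \<subseteq> J \<Longrightarrow> on_coord e w S \<noteq> 0 \<Longrightarrow> S = C"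
      have "on_coord e w C \<noteq> 0" using True C(2) by blast
      then have C0: "w C \<noteq> 0" "e \<in> C" by (auto simp: on_coord_def split: if_splits)
      have single: "wint J (on_coord e w) f = w C * f C" for f
        using wint_single[of J C "on_coord e w" f, OF J C] C0
        by (simp add: on_coord_def[of e w C])
      \<comment> \<open>If \<open>S\<close> missed some \<open>i\<close> in \<open>C - {e}\<close>,
        then \<open>i\<close> and \<open>e\<close> would be jointly present and jointly absent with
        positive mass, while \<open>e\<close> without \<open>i\<close> has mass zero. This violates
        the Rayleigh inequality.\<close>
      have above: "C - {e} \<subseteq> S" if S: "S \<subseteq> J" "w S \<noteq> 0" "e \<notin> S" for S
      proof (rule ccontr)
        assume "\<not> C - {e} \<subseteq> S"
        then obtain i where i: "i \<in> C" "i \<noteq> e" "i \<notin> S" by auto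
        have "0 < mass J (on_coord i (on_coord e w))"
          using J nn i C(1) C0 by (intro mass_pos[of J _ C]) (auto simp: on_coord_def)
        moreover have "0 < mass J (off_coord i (off_coord e w))"
          using J nn i S by (intro mass_pos[of J _ S]) (auto simp: off_coord_def)
        moreover have "off_coord i (on_coord e w) T = 0" if "T \<subseteq> J" for T
          using C(2)[OF that] i(1) unfolding off_coord_def by metis
        then have "mass J (off_coord i (on_coord e w)) = 0" by (simp add: wint_def)
        moreover have "i \<in> J" using i C(1) by auto
        ultimately show False
          using pairwise_negative_correlation[OF w _ e i(2)]
          by (metis mult_pos_pos mult_zero_left not_less)
      qed
      have FC: "F C = F (C - {e})"
        using dep[unfolded depends_only_on_def, rule_format, of C "C - {e}"] C(1) by auto
      have "F C * mass J (off_coord e w) \<le> wint J (off_coord e w) F"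
        unfolding wint_def sum_distrib_left
      proof (intro sum_mono)
        fix S assume "S \<in> Pow J"
        then have S: "S \<subseteq> J" by simp
        have "off_coord e w S * F C \<le> off_coord e w S * F S"
        proof (cases "off_coord e w S = 0")
          case False
          then have "C - {e} \<subseteq> S" using S by (intro above) (auto simp: off_coord_def split: if_splits)
          then have "F C \<le> F S" unfolding FC using S C(1) by (intro mono_onD[OF F]) auto
          then show ?thesis
            using nn[OF S] by (intro mult_left_mono) (auto simp: off_coord_def)
        qed simp
        then show "F C * (off_coord e w S * 1) \<le> off_coord e w S * F S" by (simp add: mult.commute)
      qed
      then show ?thesis
        using nn[OF C(1)] by (simp add: single mult.assoc mult.commute[of _ "w C"] mult_left_mono)
    next
      fix i assume i: "i \<in> J" and pos: "0 < mass J (on_coord i (on_coord e w))"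
          "0 < mass J (off_coord i (on_coord e w))"
        and cor: "wint J (off_coord i (on_coord e w)) F * mass J (on_coord i (on_coord e w))
          \<le> wint J (on_coord i (on_coord e w)) F * mass J (off_coord i (on_coord e w))"
      have ie: "i \<noteq> e"
      proof
        assume "i = e"
        then have "off_coord i (on_coord e w) S = 0" for S
          by (simp add: on_coord_def off_coord_def)
        then show False using pos(2) by (simp add: wint_def)
      qed
      have pos': "0 < mass J (on_coord i w)" "0 < mass J (off_coord i w)"
      proof -
        have "mass J (on_coord e (on_coord i w)) \<le> mass J (on_coord i w)"
          "mass J (on_coord e (off_coord i w)) \<le> mass J (off_coord i w)"
          unfolding wint_def using nn by (auto intro!: sum_mono simp: on_coord_def off_coord_def)
        then show "0 < mass J (on_coord i w)" "0 < mass J (off_coord i w)"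
          using pos by (simp_all add: on_coord_commute(1)[of i e] on_coord_commute(3)[of e i])
      qed
      note nd = nondegenerate_coord[OF w i pos']
      have IH_on: "wint J (on_coord i (on_coord e w)) F * mass J (on_coord i (off_coord e w))
          \<le> wint J (on_coord i (off_coord e w)) F * mass J (on_coord i (on_coord e w))"
        using less.hyps[OF nd(3,1)] by (simp add: on_coord_commute(1)[of i e] on_coord_commute(3)[of i e])
      have IH_off: "wint J (off_coord i (on_coord e w)) F * mass J (off_coord i (off_coord e w))
          \<le> wint J (off_coord i (off_coord e w)) F * mass J (off_coord i (on_coord e w))"
        using less.hyps[OF nd(4,2)] by (simp add: on_coord_commute(2)[of i e] on_coord_commute(3)[of e i])
      show ?thesis
        unfolding wint_split[of J "on_coord e w" _ i] wint_split[of J "off_coord e w" _ i]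
        by (rule mixture_le[OF pos IH_on IH_off pairwise_negative_correlation[OF w i e ie] cor])
    qed
  qed
qed

text \<open>The covariance is the sum of the averaged conditional covariances, nonpositive by
  \<open>on\<close> and \<open>off\<close>, and the covariance of the conditional means, nonpositive
  because by \<open>opp\<close> the two means move in opposite directions between the parts.\<close>

lemma mixture_product_le:
  fixes a b \<alpha> \<beta> \<gamma> \<delta> \<phi> \<psi> :: real
  assumes ab: "0 < a" "0 < b" and on: "\<phi> * a \<le> \<alpha> * \<gamma>" and off: "\<psi> * b \<le> \<beta> * \<delta>"
    and opp: "(\<alpha> * b - \<beta> * a) * (\<gamma> * b - \<delta> * a) \<le> 0"
  shows "(\<phi> + \<psi>) * (a + b) \<le> (\<alpha> + \<beta>) * (\<gamma> + \<delta>)"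
proof -
  define x y x' y' where "x = \<alpha> / a" and "y = \<beta> / b" and "x' = \<gamma> / a" and "y' = \<delta> / b"
  have xy: "\<alpha> = x * a" "\<beta> = y * b" "\<gamma> = x' * a" "\<delta> = y' * b"
    using ab by (simp_all add: x_def y_def x'_def y'_def)
  have "\<phi> * a \<le> (x * x' * a) * a" "\<psi> * b \<le> (y * y' * b) * b"
    using on off by (simp_all add: xy mult_ac)
  then have "\<phi> \<le> x * x' * a" "\<psi> \<le> y * y' * b" using ab by simp_all
  then have "(\<phi> + \<psi>) * (a + b) \<le> (x * x' * a + y * y' * b) * (a + b)"
    using ab by (intro mult_right_mono) auto
  moreover have "(a * b) * (a * b) * ((x - y) * (x' - y')) \<le> 0"
    using opp by (simp add: xy algebra_simps)
  then have "(x - y) * (x' - y') \<le> 0"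
    using ab by (simp add: mult_le_0_iff)
  then have "a * b * ((x - y) * (x' - y')) \<le> 0"
    using ab by (simp add: mult_le_0_iff)
  ultimately show ?thesis by (simp add: xy algebra_simps)
qed

lemma depends_only_on_mono:
  assumes "depends_only_on J A F" "A \<subseteq> B"
  shows "depends_only_on J B F"
  unfolding depends_only_on_def
proof (intro ballI impI)
  fix S T assume ST: "S \<in> Pow J" "T \<in> Pow J" "S \<inter> B = T \<inter> B"
  have "S \<inter> A = T \<inter> A" using ST(3) assms(2) by blast
  then show "F S = F T"
    by (rule assms(1)[unfolded depends_only_on_def, rule_format, OF ST(1,2)])
qed

lemma stable_weight_negatively_associated:
  assumes "stable_weight J w" and F: "mono_on (Pow J) F" and G: "mono_on (Pow J) G"
    and AB: "A \<subseteq> J" "B \<subseteq> J" "A \<inter> B = {}"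
    and dep: "depends_only_on J A F" "depends_only_on J B G"
  shows "wint J w (\<lambda>S. F S * G S) * mass J w \<le> wint J w F * wint J w G"
  using assms(1)
proof (induction "card (support J w)" arbitrary: w rule: less_induct)
  case less
  note w = less.prems(1)
  have J: "finite J" using stable_weight_finite[OF w] .
  show ?case
  proof (rule stable_weight_cases[OF w F])
    fix C assume C: "C \<subseteq> J" "\<And>S. S \<subseteq> J \<Longrightarrow> w S \<noteq> 0 \<Longrightarrow> S = C"
    have "wint J w f = w C * f C" for f by (rule wint_single[OF J C])
    then show ?thesis by simp
  next
    fix i assume i: "i \<in> J" and pos: "0 < mass J (on_coord i w)" "0 < mass J (off_coord i w)"
      and cor: "wint J (off_coord i w) F * mass J (on_coord i w)
        \<le> wint J (on_coord i w) F * mass J (off_coord i w)"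
    note nd = nondegenerate_coord[OF w i pos]
    \<comment> \<open>The coordinate \<open>i\<close> lies outside \<open>A\<close> or outside
      \<open>B\<close>. If it lies in \<open>B\<close>, then \<open>F\<close> does not depend on it,
      and its correlation with \<open>F\<close> is both nonnegative and nonpositive, so the first
      factor is zero. Otherwise \<open>G\<close> does not depend on it, and the factors have
      opposite signs.\<close>
    have "(wint J (on_coord i w) F * mass J (off_coord i w) - wint J (off_coord i w) F * mass J (on_coord i w))
       * (wint J (on_coord i w) G * mass J (off_coord i w) - wint J (off_coord i w) G * mass J (on_coord i w)) \<le> 0"
    proof (cases "i \<in> B")
      case True
      then have "depends_only_on J (J - {i}) F"
        using AB by (intro depends_only_on_mono[OF dep(1)]) auto
      then show ?thesis
        using coordinate_negatively_correlated[OF w i F] cor by simp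
    next
      case False
      then have "depends_only_on J (J - {i}) G"
        using AB by (intro depends_only_on_mono[OF dep(2)]) auto
      then show ?thesis
        using coordinate_negatively_correlated[OF w i G] cor
        by (intro mult_nonneg_nonpos) auto
    qed
    then show ?thesis
      unfolding wint_split[of J w _ i]
      by (intro mixture_product_le pos less.hyps nd)
  qed
qed

section \<open>Strongly Rayleigh measures\<close>

lemma stable_weight_pmf:
  assumes "finite J" "strongly_Rayleigh J \<mu>"
  shows "stable_weight J (pmf \<mu>)"
  using assms by (simp add: stable_weight_def strongly_Rayleigh_def gen_poly_wpoly)

lemma strongly_Rayleigh_projection:
  assumes J: "finite J" and \<mu>: "strongly_Rayleigh J \<mu>" and \<nu>: "is_projection J \<mu> S \<nu>"
  shows "strongly_Rayleigh S \<nu>"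
  unfolding strongly_Rayleigh_def stable_def
proof (intro allI impI)
  fix z :: "'a \<Rightarrow> complex" assume z: "\<forall>j\<in>S. 0 < Im (z j)"
  have "gen_poly J \<mu> (\<lambda>i. if i \<in> S then z i else 1) \<noteq> 0"
    unfolding gen_poly_wpoly using z
    by (intro stable_weight_nonzero[OF stable_weight_pmf[OF J \<mu>]]) auto
  then show "gen_poly S \<nu> z \<noteq> 0"
    using \<nu> by (simp add: is_projection_def)
qed

lemma strongly_Rayleigh_external_field:
  assumes J: "finite J" and \<mu>: "strongly_Rayleigh J \<mu>" and \<nu>: "is_external_field J \<mu> a \<nu>"
  shows "strongly_Rayleigh J \<nu>"
proof -
  have a: "0 \<le> a i" if "i \<in> J" for i using \<nu> that by (simp add: is_external_field_def)
  have Z: "gen_poly J \<mu> (\<lambda>i. of_real (a i)) \<noteq> 0" using \<nu> by (simp add: is_external_field_def)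
  have "gen_poly J \<mu> (\<lambda>i. of_real (a i)) = of_real (\<Sum>S\<in>Pow J. pmf \<mu> S * (\<Prod>i\<in>S. a i))"
    by (simp add: gen_poly_def)
  then have "(\<Sum>S\<in>Pow J. pmf \<mu> S * (\<Prod>i\<in>S. a i)) \<noteq> 0" using Z by (metis of_real_0)
  then obtain S where "S \<in> Pow J" "pmf \<mu> S * (\<Prod>i\<in>S. a i) \<noteq> 0"
    by (meson sum.not_neutral_contains_not_neutral)
  then have "stable_weight J (\<lambda>S. pmf \<mu> S * (\<Prod>i\<in>S. a i))"
    by (intro stable_weight_field[OF stable_weight_pmf[OF J \<mu>] a]) auto
  then have "stable J (wpoly J (\<lambda>S. of_real (pmf \<mu> S) * (\<Prod>i\<in>S. of_real (a i))))"
    by (simp add: stable_weight_def)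
  then have "stable J (\<lambda>z. gen_poly J \<mu> (\<lambda>i. of_real (a i) * z i))"
    by (simp add: stable_def wpoly_field gen_poly_wpoly)
  then show ?thesis
    using \<nu> Z by (simp add: strongly_Rayleigh_def stable_def is_external_field_def)
qed

lemma obtained_from_strongly_Rayleigh:
  assumes "obtained_from I \<mu> J \<nu>"
    and "finite I" "measure_on I \<mu>" "strongly_Rayleigh I \<mu>"
  shows "finite J \<and> measure_on J \<nu> \<and> strongly_Rayleigh J \<nu>"
  using assms(1)
proof induction
  case start
  then show ?case using assms by simp
next
  case (projection J \<nu> S \<nu>')
  then show ?case
    using strongly_Rayleigh_projection[of J \<nu> S \<nu>'] finite_subset[of S J]
    by (auto simp: is_projection_def)
next
  case (external_field J \<nu> a \<nu>')
  then show ?case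
    using strongly_Rayleigh_external_field[of J \<nu> a \<nu>'] by (auto simp: is_external_field_def)
qed

text \<open>\<open>conditioned\<close> drops the coordinates in \<open>K\<close>, whereas
  \<open>w\<close> keeps the index set \<open>J\<close>. The dropping is transferred to the test
  function, which sees only \<open>S - K\<close>.\<close>

lemma expectation_conditioned:
  fixes f :: "'a set \<Rightarrow> real"
  assumes J: "finite J" and \<mu>: "measure_on J \<mu>" 
    and pos: "0 < measure_pmf.prob \<mu> (cond_event K x)"
    and ev: "\<And>S. S \<subseteq> J \<Longrightarrow> S \<in> cond_event K x \<longleftrightarrow> S \<inter> K = X"
  defines "w \<equiv> \<lambda>S. if S \<inter> K = X then pmf \<mu> S else 0"
  shows "measure_pmf.expectation (conditioned \<mu> K x) f = wint J w (\<lambda>S. f (S - K)) / mass J w"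
    and "mass J w = measure_pmf.prob \<mu> (cond_event K x)"
proof -
  let ?A = "cond_event K x"
  have ne: "set_pmf \<mu> \<inter> ?A \<noteq> {}"
    using pos measure_pmf_zero_iff[of \<mu> ?A] by auto
  have sub: "set_pmf \<mu> \<subseteq> Pow J" using \<mu> by (simp add: measure_on_def)
  have "measure_pmf.prob \<mu> ?A = measure_pmf.prob \<mu> (?A \<inter> Pow J)"
    using sub by (intro measure_prob_cong_0) (auto simp: set_pmf_iff)
  also have "\<dots> = (\<Sum>S\<in>?A \<inter> Pow J. pmf \<mu> S)"
    using J by (intro measure_measure_pmf_finite) auto
  also have "\<dots> = mass J w"
    unfolding wint_def w_def using J ev by (intro sum.mono_neutral_cong_left) auto
  finally show mass: "mass J w = measure_pmf.prob \<mu> ?A" by simp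
  have pc: "pmf (cond_pmf \<mu> ?A) S = w S / mass J w" if "S \<subseteq> J" for S
    unfolding mass using ev[OF that] by (simp add: pmf_cond[OF ne] w_def)
  have "measure_pmf.expectation (conditioned \<mu> K x) f
      = measure_pmf.expectation (cond_pmf \<mu> ?A) (\<lambda>S. f (S - K))"
    by (simp add: conditioned_def)
  also have "\<dots> = (\<Sum>S\<in>Pow J. pmf (cond_pmf \<mu> ?A) S * f (S - K))"
    using J sub ne by (subst integral_measure_pmf[of "Pow J"]) auto
  also have "\<dots> = (\<Sum>S\<in>Pow J. w S * f (S - K) / mass J w)"
    using pc by (intro sum.cong refl) simp
  finally show "measure_pmf.expectation (conditioned \<mu> K x) f = wint J w (\<lambda>S. f (S - K)) / mass J w"
    by (simp add: wint_def sum_divide_distrib)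
qed

lemma strongly_Rayleigh_CNA:
  assumes J: "finite J" and \<mu>: "measure_on J \<mu>" and sR: "strongly_Rayleigh J \<mu>"
  shows "CNA J \<mu>"
  unfolding CNA_def NA_def
proof (intro allI impI, elim exE conjE)
  fix K x and F G :: "'a set \<Rightarrow> real" and A B
  assume K: "K \<subseteq> J" and x: "\<forall>i\<in>K. x i \<in> {0, 1}"
    and pos: "0 < measure_pmf.prob \<mu> (cond_event K x)"
    and F: "mono_on (Pow (J - K)) F" and G: "mono_on (Pow (J - K)) G"
    and AB: "A \<subseteq> J - K" "B \<subseteq> J - K" "A \<inter> B = {}"
    and dep: "depends_only_on (J - K) A F" "depends_only_on (J - K) B G"
  define X where "X = {i \<in> K. x i = 1}"
  define w where "w S = (if S \<inter> K = X then pmf \<mu> S else 0)" for S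
  have ev: "S \<in> cond_event K x \<longleftrightarrow> S \<inter> K = X" for S
  proof -
    have "coord i S = x i \<longleftrightarrow> (i \<in> S \<longleftrightarrow> i \<in> X)" if "i \<in> K" for i
      using x[rule_format, OF that] that by (auto simp: coord_def X_def)
    moreover have "X \<subseteq> K" by (simp add: X_def)
    ultimately show ?thesis unfolding cond_event_def by blast
  qed
  note cond = expectation_conditioned[OF J \<mu> pos ev, folded w_def]
  have mass: "0 < mass J w" using cond(2) pos by simp
  obtain S0 where "S0 \<subseteq> J" "w S0 \<noteq> 0" using mass_nonzero_witness[of J w] mass by auto
  then have w: "stable_weight J w"
    unfolding w_def[abs_def] using K
    by (intro stable_weight_restrict[OF stable_weight_pmf[OF J sR], of K X S0])
      (auto simp: X_def split: if_splits)
  \<comment> \<open>Functions on the subsets of \<open>J - K\<close> are pulled back to subsets of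
    \<open>J\<close> by removing \<open>K\<close>; they stay increasing and depend on the same
    coordinates.\<close>
  have lift_mono: "mono_on (Pow J) (\<lambda>S. f (S - K))" if "mono_on (Pow (J - K)) f" for f :: "'a set \<Rightarrow> real"
    by (intro mono_onI mono_onD[OF that]) auto
  have lift_dep: "depends_only_on J C (\<lambda>S. f (S - K))"
    if "depends_only_on (J - K) C f" "C \<subseteq> J - K" for C and f :: "'a set \<Rightarrow> real"
    unfolding depends_only_on_def
  proof (intro ballI impI)
    fix S T assume ST: "S \<in> Pow J" "T \<in> Pow J" "S \<inter> C = T \<inter> C"
    then have "(S - K) \<inter> C = (T - K) \<inter> C" by auto
    then show "f (S - K) = f (T - K)"
      using ST(1,2) by (intro that(1)[unfolded depends_only_on_def, rule_format]) auto
  qed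
  have "wint J w (\<lambda>S. F (S - K) * G (S - K)) * mass J w
      \<le> wint J w (\<lambda>S. F (S - K)) * wint J w (\<lambda>S. G (S - K))"
    using AB K
    by (intro stable_weight_negatively_associated[OF w, of _ _ A B] lift_mono lift_dep F G dep) auto
  then show "measure_pmf.expectation (conditioned \<mu> K x) (\<lambda>S. F S * G S)
      \<le> measure_pmf.expectation (conditioned \<mu> K x) F * measure_pmf.expectation (conditioned \<mu> K x) G"
    unfolding cond(1) using mass by (simp add: field_simps)
qed

theorem theorem4p9:
  fixes n :: nat and \<mu> :: "nat set pmf"
  assumes "measure_on {1..n} \<mu>"
    and "strongly_Rayleigh {1..n} \<mu>"
  shows "CNA_plus {1..n} \<mu>"
  unfolding CNA_plus_def
  using obtained_from_strongly_Rayleigh[OF _ _ assms] strongly_Rayleigh_CNA by blast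

end
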